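(* Let $n$ be a positive integer and $D\in\mathcal{D}$. The $D$-diameter restricted Hausdorff dimension $\dim_H^D$ on subsets of $\mathbb{R}^n$ has the following properties. (i) It is Lipschitz stable: $\dim_H^D f(A)\le\dim_H^D A$ for every $A\subset\mathbb{R}^n$ and every Lipschitz map $f\colon\mathbb{R}^n\to\mathbb{R}^n$. (ii) It is monotone: $A\subset B$ implies $\dim_H^D A\le\dim_H^D B$. (iii) $\dim_H^D S=\dim_H S$ for every self-similar set $S\subset\mathbb{R}^n$. (iv) It is $\sigma$-stable: $\dim_H^D\left(\bigcup_{i=1}^\infty A_i\right)=\sup_i\dim_H^D A_i$ for all $A_1,A_2,\ldots\subset\mathbb{R}^n$. (v) Every $E\subset\mathbb{R}^n$ can be covered by a $G_\delta$ set $B$ with $\dim_H^D B=\dim_H^D E$. (vi) $\dim_H^D\colon\mathcal{K}(\mathbb{R}^n)\to[0,n]$ is a Borel function. (vii) $\dim_H E\le\dim_H^D E\le\dim_P E$ for every $E\subset\mathbb{R}^n$.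
   Context: $|E|$ denotes the diameter of a set $E$. $\mathcal{D}$ is the family of all sets $D\subset(0,\infty)$ with $\inf D=0$ that are open in the Sorgenfrey topology (generated by the intervals $[a,b)$), i.e. for every $t\in D$ there is $\delta>0$ with $[t,t+\delta)\subset D$. For $D\in\mathcal{D}$, $E\subset\mathbb{R}^n$ and $s\ge0$ let $$\mathcal{H}^s_{D,\infty}(E)=\inf\left\{\sum_{i=1}^\infty|E_i|^s: E\subset\bigcup_{i=1}^\infty E_i,\ |E_i|\in D\text{ for all }i\right\},\qquad \dim_H^D E=\inf\{s\ge0:\mathcal{H}^s_{D,\infty}(E)=0\}.$$ $\dim_H$ and $\dim_P$ are the Hausdorff and packing dimensions; $\dim_P X=\inf\{\sup_i\overline{\dim}_B X_i: X=\bigcup_{i=1}^\infty X_i,\ X_i\text{ bounded}\}$, where $\overline{\dim}_B$ is the upper box dimension. $\mathcal{K}(\mathbb{R}^n)$ is the set of non-empty compact subsets of $\mathbb{R}^n$ endowed with the Hausdorff metric. A self-similar set is a nonempty compact set $S$ with $S=\bigcup_{i=1}^m f_i(S)$ for finitely many contracting similarities $f_i$ of $\mathbb{R}^n$ (no separation condition is assumed). *)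

theory Defs
  imports "HOL-Analysis.Analysis"
begin

section \<open>Diameter restricted Hausdorff dimension\<close>

text \<open>Non-emptiness must be stated: classically \<open>inf \<emptyset> = \<infinity> \<noteq> 0\<close>, but the infimum of the empty set of
  reals is unspecified in HOL.\<close>

definition diameter_families :: "real set set" where
  "diameter_families = {D. D \<subseteq> {0<..} \<and> D \<noteq> {} \<and> Inf D = 0 \<and>
     (\<forall>t\<in>D. \<exists>\<delta>>0. {t..<t + \<delta>} \<subseteq> D)}"

text \<open>Boundedness of the covering sets is explicit because \<^const>\<open>diameter\<close> is a real number and
  carries no meaning for unbounded sets. As all diameters in \<open>D\<close> are positive, \<open>powr\<close> is the usual
  power, also for \<open>s = 0\<close>.\<close>

definition restricted_content :: "real set \<Rightarrow> real \<Rightarrow> 'a::metric_space set \<Rightarrow> ennreal" where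
  "restricted_content D s A =
     (INF E\<in>{E :: nat \<Rightarrow> 'a set. A \<subseteq> (\<Union>i. E i) \<and> (\<forall>i. bounded (E i) \<and> diameter (E i) \<in> D)}.
        \<Sum>i. ennreal (diameter (E i) powr s))"

definition restricted_dim :: "real set \<Rightarrow> 'a::metric_space set \<Rightarrow> ereal" where
  "restricted_dim D A = (INF s\<in>{s. 0 \<le> s \<and> restricted_content D s A = 0}. ereal s)"

section \<open>Hausdorff and packing dimension\<close>

text \<open>The usual convention: \<open>|E|\<^sup>0 = 1\<close> for every non-empty \<open>E\<close>, and the empty set contributes
  nothing. (In HOL, \<open>0 powr 0 = 0\<close>.)\<close>

definition diameter_power :: "real \<Rightarrow> 'a::metric_space set \<Rightarrow> real" where
  "diameter_power s E = (if E = {} then 0 else if s = 0 then 1 else diameter E powr s)"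

definition hausdorff_premeasure :: "real \<Rightarrow> real \<Rightarrow> 'a::metric_space set \<Rightarrow> ennreal" where
  "hausdorff_premeasure \<delta> s A =
     (INF E\<in>{E :: nat \<Rightarrow> 'a set. A \<subseteq> (\<Union>i. E i) \<and> (\<forall>i. bounded (E i) \<and> diameter (E i) \<le> \<delta>)}.
        \<Sum>i. ennreal (diameter_power s (E i)))"

definition hausdorff_measure :: "real \<Rightarrow> 'a::metric_space set \<Rightarrow> ennreal" where
  "hausdorff_measure s A = (SUP \<delta>\<in>{0<..}. hausdorff_premeasure \<delta> s A)"

definition hausdorff_dim :: "'a::metric_space set \<Rightarrow> ereal" where
  "hausdorff_dim A = (INF s\<in>{s. 0 \<le> s \<and> hausdorff_measure s A = 0}. ereal s)"

text \<open>The following two notions are meaningful only for totally bounded sets, that is, for bounded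
  sets in Euclidean space. The upper box dimension of the empty set is \<open>0\<close>, since \<open>ln 0 = 0\<close> in HOL.\<close>

definition covering_number :: "real \<Rightarrow> 'a::metric_space set \<Rightarrow> nat" where
  "covering_number \<delta> A =
     (LEAST N. \<exists>\<U>. finite \<U> \<and> card \<U> = N \<and> A \<subseteq> \<Union>\<U> \<and> (\<forall>U\<in>\<U>. bounded U \<and> diameter U \<le> \<delta>))"

definition upper_box_dim :: "'a::metric_space set \<Rightarrow> ereal" where
  "upper_box_dim A =
     Limsup (at_right 0) (\<lambda>\<delta>. ereal (ln (real (covering_number \<delta> A)) / - ln \<delta>))"

definition packing_dim :: "'a::metric_space set \<Rightarrow> ereal" where
  "packing_dim A =
     (INF X\<in>{X :: nat \<Rightarrow> 'a set. A = (\<Union>i. X i) \<and> (\<forall>i. bounded (X i))}. SUP i. upper_box_dim (X i))"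

section \<open>Self-similar sets\<close>

definition contracting_similarity :: "('a::metric_space \<Rightarrow> 'a) \<Rightarrow> bool" where
  "contracting_similarity f \<longleftrightarrow> (\<exists>r. 0 < r \<and> r < 1 \<and> (\<forall>x y. dist (f x) (f y) = r * dist x y))"

definition self_similar :: "'a::metric_space set \<Rightarrow> bool" where
  "self_similar S \<longleftrightarrow> compact S \<and> S \<noteq> {} \<and>
     (\<exists>(m::nat) f. (\<forall>i<m. contracting_similarity (f i)) \<and> S = (\<Union>i<m. f i ` S))"

section \<open>The hyperspace of non-empty compact sets\<close>

definition compacts :: "'a::metric_space set set" where
  "compacts = {K. compact K \<and> K \<noteq> {}}"

text \<open>The value \<open>0\<close> outside \<^const>\<open>compacts\<close> is there because \<^locale>\<open>Metric_space\<close> demands a distance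
  that is non-negative and symmetric on the whole type.\<close>

definition hausdorff_dist :: "'a::metric_space set \<Rightarrow> 'a set \<Rightarrow> real" where
  "hausdorff_dist A B =
     (if A \<in> compacts \<and> B \<in> compacts
      then max (SUP a\<in>A. infdist a B) (SUP b\<in>B. infdist b A) else 0)"

lemma bdd_above_infdist_image:
  assumes "compact A"
  shows "bdd_above ((\<lambda>a. infdist a B) ` A)"
  by (intro bounded_imp_bdd_above compact_imp_bounded compact_continuous_image
        continuous_intros assms)

lemma infdist_le_hausdorff_dist:
  assumes "A \<in> compacts" "B \<in> compacts" "a \<in> A"
  shows "infdist a B \<le> hausdorff_dist A B"
proof -
  have "infdist a B \<le> (SUP a\<in>A. infdist a B)"
    using assms by (intro cSUP_upper bdd_above_infdist_image) (auto simp: compacts_def)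
  then show ?thesis
    using assms by (simp add: hausdorff_dist_def)
qed

lemma hausdorff_dist_commute: "hausdorff_dist A B = hausdorff_dist B A"
  by (auto simp: hausdorff_dist_def max.commute)

lemma Metric_space_compacts: "Metric_space (compacts :: 'a::metric_space set set) hausdorff_dist"
proof
  fix A B :: "'a set"
  show "hausdorff_dist A B = hausdorff_dist B A"
    by (rule hausdorff_dist_commute)
  show "0 \<le> hausdorff_dist A B"
  proof (cases "A \<in> compacts \<and> B \<in> compacts")
    case True
    then obtain a where "a \<in> A"
      by (auto simp: compacts_def)
    then show ?thesis
      using True infdist_le_hausdorff_dist[of A B a] infdist_nonneg[of a B] by linarith
  qed (auto simp: hausdorff_dist_def)
next
  fix A B :: "'a set"
  assume AB: "A \<in> compacts" "B \<in> compacts"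
  show "hausdorff_dist A B = 0 \<longleftrightarrow> A = B"
  proof
    assume 0: "hausdorff_dist A B = 0"
    have "X \<subseteq> Y" if XY: "X \<in> compacts" "Y \<in> compacts" "hausdorff_dist X Y = 0" for X Y :: "'a set"
    proof
      fix x assume "x \<in> X"
      then have "infdist x Y = 0"
        using infdist_le_hausdorff_dist[of X Y x] XY infdist_nonneg[of x Y] by linarith
      moreover have "closed Y" "Y \<noteq> {}"
        using XY by (auto simp: compacts_def compact_imp_closed)
      ultimately show "x \<in> Y"
        using in_closed_iff_infdist_zero by blast
    qed
    then show "A = B"
      using AB 0 hausdorff_dist_commute[of A B] by (metis subset_antisym)
  next
    assume "A = B"
    then show "hausdorff_dist A B = 0"
      using AB by (simp add: hausdorff_dist_def compacts_def)
  qed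
next
  fix A B C :: "'a set"
  assume ABC: "A \<in> compacts" "B \<in> compacts" "C \<in> compacts"
  have *: "infdist x Z \<le> hausdorff_dist X Y + hausdorff_dist Y Z"
    if XYZ: "X \<in> compacts" "Y \<in> compacts" "Z \<in> compacts" "x \<in> X" for X Y Z :: "'a set" and x
  proof -
    have Y: "compact Y" "Y \<noteq> {}"
      using XYZ by (auto simp: compacts_def)
    then obtain y where y: "y \<in> Y" "\<forall>z\<in>Y. dist x y \<le> dist x z"
      using continuous_attains_inf[of Y "dist x"] continuous_on_dist[OF continuous_on_const continuous_on_id]
      by blast
    then have "dist x y \<le> infdist x Y"
      using Y by (auto simp: infdist_notempty intro!: cINF_greatest)
    have "infdist x Z \<le> infdist y Z + dist x y"
      by (rule infdist_triangle)
    also have "\<dots> \<le> hausdorff_dist Y Z + hausdorff_dist X Y"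
      using infdist_le_hausdorff_dist[of Y Z y] infdist_le_hausdorff_dist[of X Y x] XYZ y
        \<open>dist x y \<le> infdist x Y\<close>
      by linarith
    finally show ?thesis by simp
  qed
  have "A \<noteq> {}" "C \<noteq> {}"
    using ABC by (auto simp: compacts_def)
  moreover have "infdist x A \<le> hausdorff_dist A B + hausdorff_dist B C" if "x \<in> C" for x
    using *[OF ABC(3,2,1) that] hausdorff_dist_commute[of C B] hausdorff_dist_commute[of B A] by simp
  ultimately have "max (SUP a\<in>A. infdist a C) (SUP c\<in>C. infdist c A)
      \<le> hausdorff_dist A B + hausdorff_dist B C"
    using *[OF ABC] by (intro max.boundedI cSUP_least) auto
  then show "hausdorff_dist A C \<le> hausdorff_dist A B + hausdorff_dist B C"
    using ABC by (simp add: hausdorff_dist_def[of A C])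
qed

definition compacts_borel :: "'a::metric_space set measure" where
  "compacts_borel =
     sigma compacts {U. openin (Metric_space.mtopology compacts hausdorff_dist) U}"

end

theory Submission
  imports Defs
begin

text \<open>
  Everything is reduced to statements about which exponents \<open>s\<close> make the content vanish. The content is
  countably subadditive, and for \<open>s > 0\<close> a set \<open>A\<close> of diameter at most \<open>d \<in> D\<close> has content at most
  \<open>d\<^sup>s\<close>: in a Euclidean space \<open>A\<close> can be enlarged to have diameter exactly \<open>d\<close>
  (\<open>extend_to_diameter\<close>). So only upper bounds on diameters matter, and covers can be handled almost as
  for Hausdorff measure. Monotonicity and \<open>\<sigma>\<close>-stability are immediate. For a Lipschitz map, the image of
  a covering set of diameter \<open>d\<close> splits into boundedly many sets of diameter at most \<open>d\<close>, so null
  content is preserved.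

  Sorgenfrey openness of \<open>D\<close> is exactly what allows the members of a cover to be enlarged to open sets
  at negligible cost (\<open>restricted_content_open_cover\<close>). Intersecting the open sets covering \<open>E\<close> for exponents
  decreasing to the dimension gives the \<open>G\<^sub>\<delta>\<close> hull. On compact sets the content is upper
  semicontinuous for the Hausdorff metric, and the dimension is below \<open>a\<close> iff the content vanishes
  for some positive rational exponent below \<open>a\<close>, so the dimension is a Borel function.

  A cover of small cost consists of small sets, which makes it admissible for the Hausdorff measure; this is the
  lower bound by the Hausdorff dimension. For the upper bounds,
  \<open>restricted_content_eq_0_of_covering_number\<close> uses a single scale \<open>d \<in> D\<close>: if about \<open>d\<close> to the power \<open>-t\<close>
  sets of diameter \<open>d\<close> suffice at all small scales, then the dimension is at most \<open>t\<close>. This gives the bounds by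
  the box dimension, by the dimension of the space and, through \<open>\<sigma>\<close>-stability, by the packing dimension.

  For a self-similar set \<open>S\<close> and \<open>t\<close> above its Hausdorff dimension it remains to
  bound the covering numbers by a multiple of \<open>d\<close> to the power \<open>-t\<close>. If they were larger, then \<open>S\<close> would
  contain a large separated set, and around its points more than \<open>c\<close> to the power \<open>-t\<close> disjoint copies
  of \<open>S\<close> scaled by at least \<open>c\<close>. By \<open>separated_copies_cover_sum_ge\<close> that forces the Hausdorff dimension up to \<open>t\<close>.
\<close>

section \<open>Diameters and covering numbers\<close>

lemma diameter_le_dist:
  fixes S :: "'a::metric_space set"
  assumes "0 \<le> d" and "\<And>x y. x \<in> S \<Longrightarrow> y \<in> S \<Longrightarrow> dist x y \<le> d"
  shows "diameter S \<le> d"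
  using assms by (auto simp: diameter_def intro!: cSUP_least)

lemma diameter_insert_le:
  fixes p q :: "'a::metric_space"
  assumes "bounded E"
  shows "diameter (insert p E) \<le> diameter (insert q E) + dist p q"
proof (rule diameter_le_dist)
  have b: "bounded (insert q E)"
    using assms by simp
  show "0 \<le> diameter (insert q E) + dist p q"
    using diameter_ge_0[OF b] by simp
  fix x y assume xy: "x \<in> insert p E" "y \<in> insert p E"
  have *: "dist u v \<le> diameter (insert q E)" if "u \<in> insert q E" "v \<in> insert q E" for u v
    using diameter_bounded_bound[OF b that] .
  have **: "dist p v \<le> diameter (insert q E) + dist p q" if "v \<in> E" for v
    using *[of q v] that dist_triangle[of p v q] by (simp add: dist_commute)
  show "dist x y \<le> diameter (insert q E) + dist p q"
    using xy **[of x] **[of y] *[of x y] diameter_ge_0[OF b] zero_le_dist[of p q]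
    by (elim insertE) (auto simp: dist_commute intro: add_increasing2)
qed

text \<open>Moving one extra point away from \<open>E\<close> changes the diameter continuously and without bound, so
  every value above \<open>diameter E\<close> is attained. This turns an upper bound for a diameter into a
  diameter lying in \<open>D\<close>.\<close>

lemma extend_to_diameter:
  fixes E :: "'a::euclidean_space set"
  assumes "bounded E" "diameter E \<le> d" "0 \<le> d"
  obtains F where "E \<subseteq> F" "bounded F" "diameter F = d"
proof -
  obtain E' x where E': "E \<subseteq> E'" "bounded E'" "diameter E' \<le> d" "x \<in> E'"
  proof (cases "E = {}")
    case True
    then show ?thesis using assms that[of "{0}" 0] by simp
  next
    case False
    then show ?thesis using assms that[of E] by blast
  qed
  obtain u :: 'a where u: "u \<in> Basis"
    using nonempty_Basis by blast
  define h where "h t = diameter (insert (x + t *\<^sub>R u) E')" for t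
  have "1-lipschitz_on {0..d} h"
  proof (rule lipschitz_onI)
    fix s t :: real
    have "dist (x + s *\<^sub>R u) (x + t *\<^sub>R u) = dist s t"
      using u by (simp add: dist_norm flip: scaleR_diff_left)
    then show "dist (h s) (h t) \<le> 1 * dist s t"
      using diameter_insert_le[OF E'(2), of "x + s *\<^sub>R u" "x + t *\<^sub>R u"]
        diameter_insert_le[OF E'(2), of "x + t *\<^sub>R u" "x + s *\<^sub>R u"]
      using norm_Basis[OF u] by (simp add: h_def dist_real_def dist_commute abs_le_iff)
  qed simp
  then have cont: "continuous_on {0..d} h"
    by (rule lipschitz_on_continuous_on)
  have h0: "h 0 \<le> d"
    using E' by (simp add: h_def insert_absorb)
  have "dist (x + d *\<^sub>R u) x \<le> h d"
    unfolding h_def using E' by (intro diameter_bounded_bound) auto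
  then have hd: "d \<le> h d"
    using u \<open>0 \<le> d\<close> by (simp add: dist_norm)
  obtain t where "h t = d"
    using IVT'[OF h0 hd \<open>0 \<le> d\<close> cont] by blast
  then show thesis
    using E' that[of "insert (x + t *\<^sub>R u) E'"] by (auto simp: h_def)
qed

lemma open_thickening:
  fixes E :: "'a::metric_space set"
  assumes "bounded E" "0 < e"
  obtains U where "open U" "E \<subseteq> U" "bounded U" "diameter E \<le> diameter U"
    "diameter U \<le> diameter E + e"
proof -
  define U where "U = (\<Union>x\<in>E. ball x (e / 2))"
  have d: "dist x y \<le> diameter E + e" if "x \<in> U" "y \<in> U" for x y
  proof -
    obtain a b where ab: "a \<in> E" "b \<in> E" "dist a x < e / 2" "dist b y < e / 2"
      using \<open>x \<in> U\<close> \<open>y \<in> U\<close> by (auto simp: U_def)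
    then show ?thesis
      using diameter_bounded_bound[OF assms(1), of a b] dist_triangle[of x y a]
        dist_triangle[of a y b] by (simp add: dist_commute)
  qed
  have "open U" "E \<subseteq> U"
    using \<open>0 < e\<close> by (auto simp: U_def)
  moreover have "bounded U"
    using d by (auto simp: bounded_two_points)
  moreover have "diameter U \<le> diameter E + e"
    using d assms diameter_ge_0[OF assms(1)] by (intro diameter_le_dist) auto
  ultimately show thesis
    using that diameter_subset by blast
qed

lemma open_thickening_powr:
  fixes E :: "'a::metric_space set"
  assumes "bounded E" "0 < e" "0 < s" "0 < r"
  obtains U where "open U" "E \<subseteq> U" "bounded U" "diameter E \<le> diameter U"
    "diameter U < diameter E + r" "diameter U powr s \<le> diameter E powr s + e"
proof -
  let ?d = "diameter E"
  have "0 \<le> ?d"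
    using assms diameter_ge_0 by blast
  then have "continuous_on {?d..} (\<lambda>x. x powr s)"
    using \<open>0 < s\<close> by (intro continuous_on_powr' continuous_intros) auto
  then obtain \<rho> where \<rho>: "\<rho> > 0"
    "\<And>x. x \<ge> ?d \<Longrightarrow> dist x ?d < \<rho> \<Longrightarrow> dist (x powr s) (?d powr s) < e"
    unfolding continuous_on_iff using \<open>0 < e\<close> by force
  obtain U where U: "open U" "E \<subseteq> U" "bounded U" "?d \<le> diameter U"
    "diameter U \<le> ?d + min \<rho> r / 2"
    using open_thickening[OF assms(1), of "min \<rho> r / 2"] \<rho>(1) \<open>0 < r\<close> by auto
  then have "dist (diameter U) ?d < \<rho>" "diameter U < ?d + r"
    using \<rho>(1) \<open>0 < r\<close> by (auto simp: dist_real_def)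
  then show thesis
    using that U \<rho>(2)[of "diameter U"] by (force simp: dist_real_def)
qed

text \<open>The cells of a grid adapted to \<open>A\<close>. That the bound depends only on \<open>K\<close> and not on \<open>A\<close> gives the
  Lipschitz stability; its growth in \<open>K\<close> gives the bound on dimensions by that of the space.\<close>

lemma cover_by_small_sets:
  fixes A :: "'a::euclidean_space set"
  assumes "bounded A" "diameter A \<le> d" "0 < d" "0 < K"
  obtains \<U> where "finite \<U>" "card \<U> \<le> (2 * K + 1) ^ DIM('a)" "A \<subseteq> \<Union>\<U>"
    "\<And>U. U \<in> \<U> \<Longrightarrow> bounded U \<and> diameter U \<le> real DIM('a) * d / real K"
proof (cases "A = {}")
  case True
  then show ?thesis using that[of "{}"] by simp
next
  case False
  then obtain a where a: "a \<in> A" by blast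
  \<comment> \<open>the cells of the grid of mesh \<open>d / K\<close> centred at \<open>a\<close>\<close>
  define q where "q x b = \<lfloor>((x - a) \<bullet> b) * K / d\<rfloor>" for x b :: 'a
  define cell where "cell v = {x \<in> A. \<forall>b\<in>Basis. q x b = v b}" for v
  define V where "V = (Basis \<rightarrow>\<^sub>E {-int K..int K} :: ('a \<Rightarrow> int) set)"
  have V: "finite V" "card V = (2 * K + 1) ^ DIM('a)"
    by (auto simp: V_def card_PiE intro!: finite_PiE)
       (simp add: nat_add_distrib nat_mult_distrib)
  have q: "q x b \<in> {-int K..int K}" if "x \<in> A" "b \<in> Basis" for x b
  proof -
    have "\<bar>(x - a) \<bullet> b\<bar> \<le> d"
      using Basis_le_norm[OF that(2), of "x - a"] diameter_bounded_bound[OF assms(1) that(1) a]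
        assms(2) by (simp add: dist_norm)
    then have "\<bar>(x - a) \<bullet> b\<bar> * K \<le> d * K"
      by (rule mult_right_mono) simp
    then have "\<bar>((x - a) \<bullet> b) * K / d\<bar> \<le> K"
      using \<open>0 < d\<close> by (simp add: abs_mult pos_divide_le_eq mult.commute)
    then have "- real K \<le> ((x - a) \<bullet> b) * K / d" "((x - a) \<bullet> b) * K / d < real K + 1"
      by linarith+
    then show ?thesis
      by (simp add: q_def le_floor_iff floor_le_iff)
  qed
  have "A \<subseteq> \<Union>(cell ` V)"
  proof
    fix x assume x: "x \<in> A"
    have "restrict (q x) Basis \<in> V" "x \<in> cell (restrict (q x) Basis)"
      using x q by (auto simp: V_def cell_def)
    then show "x \<in> \<Union>(cell ` V)" by blast
  qed
  moreover have "bounded (cell v)" for v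
    by (rule bounded_subset[OF assms(1)]) (auto simp: cell_def)
  moreover have "diameter (cell v) \<le> real DIM('a) * d / real K" for v
  proof (rule diameter_le_dist)
    fix x y assume xy: "x \<in> cell v" "y \<in> cell v"
    have *: "\<bar>(x - y) \<bullet> b\<bar> \<le> d / K" if "b \<in> Basis" for b
    proof -
      have "q x b = q y b"
        using xy that by (auto simp: cell_def)
      then have "\<bar>((x - a) \<bullet> b) * K / d - ((y - a) \<bullet> b) * K / d\<bar> \<le> 1"
        unfolding q_def by linarith
      moreover have "((x - a) \<bullet> b) * K / d - ((y - a) \<bullet> b) * K / d = ((x - y) \<bullet> b) * (K / d)"
        by (simp add: inner_diff_left algebra_simps diff_divide_distrib)
      ultimately have "\<bar>(x - y) \<bullet> b\<bar> * (K / d) \<le> 1"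
        using \<open>0 < d\<close> by (simp add: abs_mult)
      then show ?thesis
        using \<open>0 < d\<close> \<open>0 < K\<close> by (simp add: field_simps)
    qed
    have "dist x y \<le> (\<Sum>b\<in>Basis. \<bar>(x - y) \<bullet> b\<bar>)"
      by (simp add: dist_norm norm_le_l1)
    also have "\<dots> \<le> (\<Sum>b\<in>(Basis::'a set). d / K)"
      by (intro sum_mono *)
    finally show "dist x y \<le> real DIM('a) * d / real K"
      by simp
  qed (use \<open>0 < d\<close> in simp)
  ultimately show thesis
    using that[of "cell ` V"] V card_image_le[OF V(1), of cell] by force
qed

lemma covering_number_le:
  assumes "finite \<U>" "A \<subseteq> \<Union>\<U>" "\<And>U. U \<in> \<U> \<Longrightarrow> bounded U \<and> diameter U \<le> \<delta>"
  shows "covering_number \<delta> A \<le> card \<U>"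
  unfolding covering_number_def using assms by (intro Least_le) blast

lemma covering_number_le_scale:
  fixes A :: "'a::euclidean_space set"
  assumes "bounded A" "diameter A \<le> d" "0 < d" "0 < K" "real DIM('a) * d / real K \<le> \<delta>"
  shows "covering_number \<delta> A \<le> (2 * K + 1) ^ DIM('a)"
proof -
  obtain \<U> where "finite \<U>" "card \<U> \<le> (2 * K + 1) ^ DIM('a)" "A \<subseteq> \<Union>\<U>"
    "\<And>U. U \<in> \<U> \<Longrightarrow> bounded U \<and> diameter U \<le> real DIM('a) * d / real K"
    using cover_by_small_sets[OF assms(1-4)] by metis
  then show ?thesis
    using covering_number_le[of \<U> A \<delta>] assms(5) by fastforce
qed

lemma ex_scale_factor: "\<exists>K::nat. 0 < K \<and> x \<le> real K" for x :: real
  by (meson gt_ex linorder_not_less of_nat_0_le_iff order_less_imp_le order_trans real_arch_simple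
      zero_less_Suc of_nat_le_iff le_SucI order_refl)

lemma covering_number_cover:
  fixes A :: "'a::euclidean_space set"
  assumes "bounded A" "0 < \<delta>"
  obtains \<U> where "finite \<U>" "card \<U> = covering_number \<delta> A" "A \<subseteq> \<Union>\<U>"
    "\<And>U. U \<in> \<U> \<Longrightarrow> bounded U \<and> diameter U \<le> \<delta>"
proof -
  let ?d = "diameter A + 1"
  have d: "0 < ?d"
    using diameter_ge_0[OF assms(1)] by simp
  obtain K :: nat where K: "0 < K" "real DIM('a) * ?d / \<delta> \<le> K"
    using ex_scale_factor by blast
  then have "real DIM('a) * ?d / K \<le> \<delta>"
    using \<open>0 < \<delta>\<close> by (simp add: field_simps)
  then have "\<exists>N \<U>. finite \<U> \<and> card \<U> = N \<and> A \<subseteq> \<Union>\<U> \<and> (\<forall>U\<in>\<U>. bounded U \<and> diameter U \<le> \<delta>)"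
    using cover_by_small_sets[OF assms(1) _ d K(1)] by (metis (no_types, lifting) order.trans less_add_one less_imp_le)
  from LeastI_ex[OF this] show thesis
    using that unfolding covering_number_def by blast
qed

lemma covering_number_le_powr_DIM:
  fixes A :: "'a::euclidean_space set"
  assumes "bounded A"
  obtains C where "\<And>\<delta>. 0 < \<delta> \<Longrightarrow> \<delta> < 1 \<Longrightarrow> real (covering_number \<delta> A) \<le> C * \<delta> powr - real DIM('a)"
proof -
  let ?d = "diameter A + 1" and ?n = "DIM('a)"
  have d: "0 < ?d"
    using diameter_ge_0[OF assms(1)] by simp
  have "real (covering_number \<delta> A) \<le> (2 * (real ?n * ?d) + 5) ^ ?n * \<delta> powr - real ?n"
    if \<delta>: "0 < \<delta>" "\<delta> < 1" for \<delta>
  proof -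
    define K where "K = nat \<lceil>real ?n * ?d / \<delta>\<rceil> + 1"
    have nd: "0 \<le> real ?n * ?d / \<delta>"
      using \<delta> d by simp
    then have K: "real ?n * ?d / \<delta> \<le> K" "real K \<le> real ?n * ?d / \<delta> + 2" "0 < K"
      unfolding K_def by linarith+
    then have "real ?n * ?d / K \<le> \<delta>"
      using \<delta> by (simp add: field_simps)
    then have "covering_number \<delta> A \<le> (2 * K + 1) ^ ?n"
      using covering_number_le_scale[OF assms _ d K(3)] by simp
    then have "real (covering_number \<delta> A) \<le> real ((2 * K + 1) ^ ?n)"
      by (rule of_nat_mono)
    also have "\<dots> = (2 * real K + 1) ^ ?n"
      by (simp add: add.commute)
    also have "\<dots> \<le> ((2 * (real ?n * ?d) + 5) / \<delta>) ^ ?n"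
    proof (rule power_mono)
      have arith: "k \<le> x + 2 \<Longrightarrow> 1 \<le> y \<Longrightarrow> 2 * k + 1 \<le> 2 * x + 5 * y" for k x y :: real
        by linarith
      have "1 \<le> 1 / \<delta>"
        using \<delta> by simp
      from arith[OF K(2) this] show "2 * real K + 1 \<le> (2 * (real ?n * ?d) + 5) / \<delta>"
        by (simp add: add_divide_distrib)
    qed simp
    also have "\<dots> = (2 * (real ?n * ?d) + 5) ^ ?n * \<delta> powr - real ?n"
      using \<delta> by (simp add: powr_minus powr_realpow power_mult_distrib power_inverse divide_inverse)
    finally show ?thesis .
  qed
  then show thesis
    using that by blast
qed

section \<open>The restricted content\<close>

lemma ennreal_less_add_ennreal: "x < top \<Longrightarrow> 0 < e \<Longrightarrow> x < x + ennreal e"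
  by (cases x) (auto simp: ennreal_less_iff simp flip: ennreal_plus)

lemma suminf_geometric_ennreal:
  assumes "0 \<le> e"
  shows "(\<Sum>i. ennreal (e * (1 / 2) ^ Suc i)) = ennreal e"
  using assms sums_mult[OF power_half_series, of e] by (intro suminf_ennreal_eq) auto

lemma diameter_families_ex_less:
  assumes "D \<in> diameter_families" "0 < e"
  obtains d where "d \<in> D" "0 < d" "d < e"
proof -
  have "D \<noteq> {}" "Inf D < e" "D \<subseteq> {0<..}"
    using assms by (auto simp: diameter_families_def)
  then show thesis
    using cInf_lessD[of D e] that by auto
qed

lemma diameter_families_ex_powr_less:
  assumes "D \<in> diameter_families" "0 < s" "0 < e"
  obtains d where "d \<in> D" "0 < d" "d powr s \<le> e"
proof -
  have "0 < e powr (1 / s)"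
    using \<open>0 < e\<close> by simp
  then obtain d where d: "d \<in> D" "0 < d" "d < e powr (1 / s)"
    by (rule diameter_families_ex_less[OF assms(1)])
  then have "d powr s \<le> (e powr (1 / s)) powr s"
    using \<open>0 < s\<close> by (intro powr_mono2) auto
  then show thesis
    using that d assms by (simp add: powr_powr)
qed

lemma restricted_content_mono:
  "A \<subseteq> B \<Longrightarrow> restricted_content D s A \<le> restricted_content D s B"
  unfolding restricted_content_def by (intro INF_superset_mono) auto

lemma restricted_content_upper:
  assumes "A \<subseteq> (\<Union>i. E i)" "\<And>i. bounded (E i)" "\<And>i. diameter (E i) \<in> D"
  shows "restricted_content D s A \<le> (\<Sum>i. ennreal (diameter (E i) powr s))"
  unfolding restricted_content_def using assms by (intro INF_lower) auto

lemma restricted_content_lessE: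
  assumes "restricted_content D s A < c"
  obtains E :: "nat \<Rightarrow> _" where "A \<subseteq> (\<Union>i. E i)" "\<And>i. bounded (E i)" "\<And>i. diameter (E i) \<in> D"
    "(\<Sum>i. ennreal (diameter (E i) powr s)) < c"
  using assms unfolding restricted_content_def INF_less_iff by blast

text \<open>Covers in the definition are always infinite and none of their members may be empty or a point, so
  a finite cover has to be completed by sets of negligible total contribution. This is possible
  because \<open>D\<close> contains arbitrarily small numbers and \<open>s\<close> is positive.\<close>

lemma restricted_content_le_powr:
  fixes A :: "'a::euclidean_space set"
  assumes D: "D \<in> diameter_families" and "0 < s" and "bounded A" "diameter A \<le> d" "d \<in> D"
  shows "restricted_content D s A \<le> ennreal (d powr s)"
proof (rule ennreal_le_epsilon)
  fix e :: real assume "0 < e"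
  have "0 \<le> d"
    using D \<open>d \<in> D\<close> by (auto simp: diameter_families_def)
  have "\<exists>F. bounded (F :: 'a set) \<and> diameter F \<in> D \<and> diameter F powr s \<le> e * (1 / 2) ^ Suc i" for i
  proof -
    have "0 < e * (1 / 2) ^ Suc i"
      using \<open>0 < e\<close> by simp
    then obtain r where r: "r \<in> D" "0 < r" "r powr s \<le> e * (1 / 2) ^ Suc i"
      by (rule diameter_families_ex_powr_less[OF D \<open>0 < s\<close>])
    obtain F :: "'a set" where "bounded F" "diameter F = r"
      using extend_to_diameter[of "{}" r] r by auto
    then show ?thesis using r by blast
  qed
  then obtain F :: "nat \<Rightarrow> 'a set" where F: "\<And>i. bounded (F i)" "\<And>i. diameter (F i) \<in> D"
    "\<And>i. diameter (F i) powr s \<le> e * (1 / 2) ^ Suc i"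
    by metis
  obtain A' where A': "A \<subseteq> A'" "bounded A'" "diameter A' = d"
    using extend_to_diameter assms(3,4) \<open>0 \<le> d\<close> by blast
  define E where "E i = (case i of 0 \<Rightarrow> A' | Suc j \<Rightarrow> F j)" for i
  have "A \<subseteq> E 0"
    using A' by (simp add: E_def)
  then have "A \<subseteq> (\<Union>i. E i)"
    by blast
  then have "restricted_content D s A \<le> (\<Sum>i. ennreal (diameter (E i) powr s))"
    using A' F \<open>d \<in> D\<close> by (intro restricted_content_upper) (auto simp: E_def split: nat.split)
  also have "\<dots> = (\<Sum>j. ennreal (diameter (E (j + 1)) powr s)) + (\<Sum>j<1. ennreal (diameter (E j) powr s))"
    by (rule suminf_offset) simp
  also have "\<dots> = ennreal (d powr s) + (\<Sum>i. ennreal (diameter (F i) powr s))"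
    by (simp add: E_def A'(3) add.commute)
  also have "(\<Sum>i. ennreal (diameter (F i) powr s)) \<le> (\<Sum>i. ennreal (e * (1 / 2) ^ Suc i))"
    using F(3) by (intro suminf_le ennreal_leI) auto
  also have "\<dots> = ennreal e"
    using \<open>0 < e\<close> by (intro suminf_geometric_ennreal) simp
  finally show "restricted_content D s A \<le> ennreal (d powr s) + ennreal e"
    by simp
qed

lemma restricted_content_empty:
  assumes "D \<in> diameter_families" "0 < s"
  shows "restricted_content D s ({} :: 'a::euclidean_space set) = 0"
proof -
  have "restricted_content D s ({} :: 'a set) \<le> 0 + ennreal e" if e: "0 < e" for e
  proof -
    obtain d where d: "d \<in> D" "0 < d" "d powr s \<le> e"
      using diameter_families_ex_powr_less[OF assms e] by blast
    then show ?thesis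
      using restricted_content_le_powr[OF assms, of "{} :: 'a set" d] ennreal_leI[OF d(3)] by auto
  qed
  from ennreal_le_epsilon[OF this] show ?thesis
    by simp
qed

lemma restricted_content_UN_le:
  fixes A :: "nat \<Rightarrow> 'a::metric_space set"
  shows "restricted_content D s (\<Union>i. A i) \<le> (\<Sum>i. restricted_content D s (A i))"
proof (rule ennreal_le_epsilon)
  fix e :: real
  assume e: "0 < e" and fin: "(\<Sum>i. restricted_content D s (A i)) < top"
  have "\<exists>E :: nat \<Rightarrow> 'a set. A i \<subseteq> (\<Union>j. E j) \<and> (\<forall>j. bounded (E j) \<and> diameter (E j) \<in> D) \<and>
      (\<Sum>j. ennreal (diameter (E j) powr s)) \<le> restricted_content D s (A i) + ennreal (e * (1 / 2) ^ Suc i)"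
    for i
  proof -
    have "restricted_content D s (A i) < top"
      using ennreal_suminf_lessD[OF fin] .
    then have "restricted_content D s (A i) < restricted_content D s (A i) + ennreal (e * (1 / 2) ^ Suc i)"
      using e by (intro ennreal_less_add_ennreal) auto
    from restricted_content_lessE[OF this] show ?thesis
      by (metis less_imp_le)
  qed
  then obtain E :: "nat \<Rightarrow> nat \<Rightarrow> 'a set" where E: "\<And>i. A i \<subseteq> (\<Union>j. E i j)"
    "\<And>i j. bounded (E i j)" "\<And>i j. diameter (E i j) \<in> D"
    "\<And>i. (\<Sum>j. ennreal (diameter (E i j) powr s)) \<le> restricted_content D s (A i) + ennreal (e * (1 / 2) ^ Suc i)"
    by metis
  define F where "F k = (case prod_decode k of (i, j) \<Rightarrow> E i j)" for k
  have "(\<Union>i. A i) \<subseteq> (\<Union>k. F k)"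
  proof
    fix x assume "x \<in> (\<Union>i. A i)"
    then obtain i j where "x \<in> E i j"
      using E(1) by blast
    then have "x \<in> F (prod_encode (i, j))"
      by (simp add: F_def)
    then show "x \<in> (\<Union>k. F k)" by blast
  qed
  then have "restricted_content D s (\<Union>i. A i) \<le> (\<Sum>k. ennreal (diameter (F k) powr s))"
    using E by (intro restricted_content_upper) (auto simp: F_def split: prod.split)
  also have "\<dots> = (\<Sum>k. (\<lambda>(i, j). ennreal (diameter (E i j) powr s)) (prod_decode k))"
    by (simp add: F_def case_prod_unfold)
  also have "\<dots> = (\<Sum>i. \<Sum>j. ennreal (diameter (E i j) powr s))"
    by (rule suminf_ennreal_2dimen) simp
  also have "\<dots> \<le> (\<Sum>i. restricted_content D s (A i) + ennreal (e * (1 / 2) ^ Suc i))"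
    by (intro suminf_le E) auto
  also have "\<dots> = (\<Sum>i. restricted_content D s (A i)) + (\<Sum>i. ennreal (e * (1 / 2) ^ Suc i))"
    by (rule suminf_add[symmetric]) auto
  also have "(\<Sum>i. ennreal (e * (1 / 2) ^ Suc i)) = ennreal e"
    using e by (intro suminf_geometric_ennreal) simp
  finally show "restricted_content D s (\<Union>i. A i) \<le> (\<Sum>i. restricted_content D s (A i)) + ennreal e" .
qed

lemma restricted_content_UN_eq_0:
  fixes A :: "nat \<Rightarrow> 'a::metric_space set"
  assumes "\<And>i. restricted_content D s (A i) = 0"
  shows "restricted_content D s (\<Union>i. A i) = 0"
  using restricted_content_UN_le[of D s A] assms by simp

lemma restricted_content_le_covering_number:
  fixes A :: "'a::euclidean_space set"
  assumes D: "D \<in> diameter_families" and "0 < s" "bounded A" "d \<in> D"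
  shows "restricted_content D s A \<le> of_nat (covering_number d A) * ennreal (d powr s)"
proof -
  have "0 < d"
    using D \<open>d \<in> D\<close> by (auto simp: diameter_families_def)
  then obtain \<U> where \<U>: "finite \<U>" "card \<U> = covering_number d A" "A \<subseteq> \<Union>\<U>"
    "\<And>U. U \<in> \<U> \<Longrightarrow> bounded U \<and> diameter U \<le> d"
    by (rule covering_number_cover[OF \<open>bounded A\<close>]) blast
  obtain u where u: "bij_betw u {0..<card \<U>} \<U>"
    using ex_bij_betw_nat_finite[OF \<U>(1)] by blast
  define U where "U i = (if i < card \<U> then u i else {})" for i
  have "A \<subseteq> (\<Union>i. U i)"
  proof
    fix x assume "x \<in> A"
    then have "x \<in> (\<Union>i\<in>{0..<card \<U>}. u i)"
      using \<U>(3) bij_betw_imp_surj_on[OF u] by auto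
    then obtain i where "i < card \<U>" "x \<in> u i"
      by auto
    then show "x \<in> (\<Union>i. U i)" by (auto simp: U_def)
  qed
  then have "restricted_content D s A \<le> restricted_content D s (\<Union>i. U i)"
    by (rule restricted_content_mono)
  also have "\<dots> \<le> (\<Sum>i. restricted_content D s (U i))"
    by (rule restricted_content_UN_le)
  also have "\<dots> = (\<Sum>i<card \<U>. restricted_content D s (U i))"
    using restricted_content_empty[OF D \<open>0 < s\<close>, where 'a = 'a]
    by (intro suminf_finite) (auto simp: U_def)
  also have "\<dots> \<le> (\<Sum>i<card \<U>. ennreal (d powr s))"
  proof (rule sum_mono)
    fix i assume "i \<in> {..<card \<U>}"
    then have "U i \<in> \<U>"
      using bij_betw_apply[OF u] by (simp add: U_def)
    then show "restricted_content D s (U i) \<le> ennreal (d powr s)"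
      using \<U>(4) by (intro restricted_content_le_powr[OF D \<open>0 < s\<close> _ _ \<open>d \<in> D\<close>]) auto
  qed
  finally show ?thesis
    by (simp add: \<U>(2))
qed

text \<open>A polynomial bound on the covering numbers at small scales kills the content at every larger
  exponent, since a single good scale \<open>d \<in> D\<close> suffices and \<open>d\<^sup>s / d\<^sup>t\<close> tends to \<open>0\<close>.\<close>

lemma restricted_content_eq_0_of_covering_number:
  fixes A :: "'a::euclidean_space set"
  assumes D: "D \<in> diameter_families" and "bounded A" "0 < s" "t < s" "0 < d0"
    and cov: "\<And>d. 0 < d \<Longrightarrow> d < d0 \<Longrightarrow> real (covering_number d A) \<le> C * d powr - t"
  shows "restricted_content D s A = 0"
proof -
  have "restricted_content D s A \<le> 0 + ennreal e" if e: "0 < e" for e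
  proof -
    let ?C = "\<bar>C\<bar> + 1"
    have "0 < e / ?C"
      using e by (intro divide_pos_pos) auto
    then have "0 < min d0 ((e / ?C) powr (1 / (s - t)))"
      using \<open>0 < d0\<close> by (simp del: divide_eq_0_iff)
    then obtain d where d: "d \<in> D" "0 < d" "d < min d0 ((e / ?C) powr (1 / (s - t)))"
      by (rule diameter_families_ex_less[OF D])
    have "d powr (s - t) \<le> ((e / ?C) powr (1 / (s - t))) powr (s - t)"
      using d \<open>t < s\<close> by (intro powr_mono2) auto
    also have "\<dots> = e / ?C"
      using \<open>t < s\<close> \<open>0 < e\<close> by (simp add: powr_powr)
    finally have *: "?C * d powr (s - t) \<le> e"
      by (simp add: field_simps)
    have "real (covering_number d A) * d powr s \<le> C * d powr - t * d powr s"
      using cov[of d] d by (intro mult_right_mono) auto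
    also have "\<dots> = C * d powr (s - t)"
      using d by (simp flip: powr_add)
    also have "\<dots> \<le> ?C * d powr (s - t)"
      by (intro mult_right_mono) auto
    also note *
    finally have "ennreal (real (covering_number d A) * d powr s) \<le> ennreal e"
      by (rule ennreal_leI)
    then have "of_nat (covering_number d A) * ennreal (d powr s) \<le> ennreal e"
      by (simp add: ennreal_mult ennreal_of_nat_eq_real_of_nat)
    then show ?thesis
      using restricted_content_le_covering_number[OF D \<open>0 < s\<close> \<open>bounded A\<close> d(1)] by simp
  qed
  from ennreal_le_epsilon[OF this] show ?thesis
    by simp
qed

text \<open>A cover that costs less than \<open>1\<close> consists of sets of diameter at most \<open>1\<close>, and raising the exponent makes
  such a cover cheaper.\<close>

lemma restricted_content_antimono:
  fixes A :: "'a::metric_space set"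
  assumes D: "D \<in> diameter_families" and "restricted_content D s A < 1" "0 \<le> s" "s \<le> t"
  shows "restricted_content D t A \<le> restricted_content D s A"
proof (rule ccontr)
  assume "\<not> ?thesis"
  then have "restricted_content D s A < min (restricted_content D t A) 1"
    using assms(2) by simp
  then obtain E :: "nat \<Rightarrow> 'a set" where E: "A \<subseteq> (\<Union>i. E i)" "\<And>i. bounded (E i)" "\<And>i. diameter (E i) \<in> D"
    "(\<Sum>i. ennreal (diameter (E i) powr s)) < min (restricted_content D t A) 1"
    by (rule restricted_content_lessE) blast
  have "ennreal (diameter (E i) powr t) \<le> ennreal (diameter (E i) powr s)" for i
  proof (rule ennreal_leI)
    have pos: "0 < diameter (E i)"
      using E(3)[of i] D by (auto simp: diameter_families_def)
    have "ennreal (diameter (E i) powr s) < 1"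
      using ennreal_suminf_lessD[OF E(4), of i] by simp
    then have "diameter (E i) powr s < 1"
      by (simp add: ennreal_less_iff flip: ennreal_1)
    then have "diameter (E i) \<le> 1"
      using \<open>0 \<le> s\<close> ge_one_powr_ge_zero[of "diameter (E i)" s] by linarith
    then show "diameter (E i) powr t \<le> diameter (E i) powr s"
      using pos \<open>s \<le> t\<close> by (intro powr_mono') auto
  qed
  then have "(\<Sum>i. ennreal (diameter (E i) powr t)) \<le> (\<Sum>i. ennreal (diameter (E i) powr s))"
    by (intro suminf_le) auto
  also have "\<dots> < restricted_content D t A"
    using E(4) by simp
  finally show False
    using restricted_content_upper[OF E(1-3), of t] by simp
qed

lemma restricted_content_eq_0_mono:
  assumes D: "D \<in> diameter_families" and "restricted_content D s A = 0" "0 \<le> s" "s \<le> t"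
  shows "restricted_content D t A = 0"
  using restricted_content_antimono[OF D _ assms(3,4), of A] assms(2) by simp

text \<open>For \<open>s = 0\<close> a cover costs \<open>1\<close> for each of its infinitely many members, so only positive exponents
  are relevant.\<close>

lemma restricted_content_0_neq_0:
  fixes A :: "'a::metric_space set"
  assumes "D \<in> diameter_families"
  shows "restricted_content D 0 A \<noteq> 0"
proof
  assume "restricted_content D 0 A = 0"
  then have "restricted_content D 0 A < ennreal 1"
    by simp
  then obtain E :: "nat \<Rightarrow> 'a set" where E: "\<And>i. diameter (E i) \<in> D"
    "(\<Sum>i. ennreal (diameter (E i) powr 0)) < ennreal 1"
    by (rule restricted_content_lessE) blast
  have "diameter (E 0) \<noteq> 0"
    using E(1)[of 0] assms by (auto simp: diameter_families_def)
  then show False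
    using ennreal_suminf_lessD[OF E(2), of 0] by simp
qed

text \<open>By Sorgenfrey openness the diameter of a set in a cover may be increased slightly without leaving \<open>D\<close>,
  so the content is already determined by open covers.\<close>

lemma restricted_content_open_cover:
  assumes D: "D \<in> diameter_families" and "0 < s" "restricted_content D s A < c"
  obtains U :: "nat \<Rightarrow> 'a::metric_space set" where "A \<subseteq> (\<Union>i. U i)" "\<And>i. open (U i)"
    "\<And>i. bounded (U i)" "\<And>i. diameter (U i) \<in> D" "(\<Sum>i. ennreal (diameter (U i) powr s)) < c"
proof -
  obtain E :: "nat \<Rightarrow> 'a set" where E: "A \<subseteq> (\<Union>i. E i)" "\<And>i. bounded (E i)"
    "\<And>i. diameter (E i) \<in> D" "(\<Sum>i. ennreal (diameter (E i) powr s)) < c"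
    by (rule restricted_content_lessE[OF assms(3)]) blast
  define S where "S = (\<Sum>i. ennreal (diameter (E i) powr s))"
  obtain c' where c': "S < c'" "c' < c"
    using dense E(4) unfolding S_def by blast
  define e where "e = enn2real (c' - S)"
  have c'top: "c' < top"
    using c'(2) top_greatest by (rule less_le_trans)
  have "S + (c' - S) = c'"
    using c' by (intro add_diff_inverse_ennreal) simp
  moreover have "c' - S < top"
    using c'top diff_le_self_ennreal le_less_trans by blast
  ultimately have Se: "S + ennreal e = c'"
    by (simp add: e_def)
  then have "0 < e"
    using c' by (cases "e \<le> 0") (auto simp: ennreal_neg)
  have "\<exists>U. open U \<and> E i \<subseteq> U \<and> bounded U \<and> diameter U \<in> D \<and>
      diameter U powr s \<le> diameter (E i) powr s + e * (1 / 2) ^ Suc i" for i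
  proof -
    obtain r where r: "0 < r" "{diameter (E i)..<diameter (E i) + r} \<subseteq> D"
      using D E(3)[of i] unfolding diameter_families_def by blast
    have "0 < e * (1 / 2) ^ Suc i"
      using \<open>0 < e\<close> by simp
    then obtain U where "open U" "E i \<subseteq> U" "bounded U" "diameter (E i) \<le> diameter U"
      "diameter U < diameter (E i) + r" "diameter U powr s \<le> diameter (E i) powr s + e * (1 / 2) ^ Suc i"
      by (rule open_thickening_powr[OF E(2)[of i] _ \<open>0 < s\<close> r(1)])
    then show ?thesis
      using r(2) by (intro exI[of _ U]) auto
  qed
  then obtain U :: "nat \<Rightarrow> 'a set" where U: "\<And>i. open (U i)" "\<And>i. E i \<subseteq> U i" "\<And>i. bounded (U i)"
    "\<And>i. diameter (U i) \<in> D"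
    "\<And>i. diameter (U i) powr s \<le> diameter (E i) powr s + e * (1 / 2) ^ Suc i"
    by metis
  have "(\<Sum>i. ennreal (diameter (U i) powr s)) \<le>
      (\<Sum>i. ennreal (diameter (E i) powr s) + ennreal (e * (1 / 2) ^ Suc i))"
    using \<open>0 < e\<close> U(5) by (intro suminf_le) (auto simp flip: ennreal_plus intro!: ennreal_leI)
  also have "\<dots> = S + (\<Sum>i. ennreal (e * (1 / 2) ^ Suc i))"
    unfolding S_def by (rule suminf_add[symmetric]) auto
  also have "(\<Sum>i. ennreal (e * (1 / 2) ^ Suc i)) = ennreal e"
    using \<open>0 < e\<close> by (intro suminf_geometric_ennreal) simp
  finally have "(\<Sum>i. ennreal (diameter (U i) powr s)) < c"
    using Se c' by simp
  moreover have "A \<subseteq> (\<Union>i. U i)"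
    using E(1) U(2) by blast
  ultimately show thesis
    using that U by blast
qed

section \<open>Stability properties of the restricted dimension\<close>

lemma restricted_dim_le:
  "0 \<le> s \<Longrightarrow> restricted_content D s A = 0 \<Longrightarrow> restricted_dim D A \<le> ereal s"
  unfolding restricted_dim_def by (intro INF_lower) auto

lemma restricted_content_eq_0_above:
  assumes D: "D \<in> diameter_families" and "restricted_dim D A < ereal s"
  shows "restricted_content D s A = 0"
proof -
  obtain r where r: "0 \<le> r" "restricted_content D r A = 0" "ereal r < ereal s"
    using assms(2) unfolding restricted_dim_def INF_less_iff by auto
  then show ?thesis
    by (intro restricted_content_eq_0_mono[OF D r(2,1)]) simp
qed

lemma restricted_dim_nonneg: "0 \<le> restricted_dim D A"
  unfolding restricted_dim_def by (intro INF_greatest) auto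

lemma restricted_dim_leI:
  assumes "0 \<le> a" and "\<And>s. 0 < s \<Longrightarrow> a < ereal s \<Longrightarrow> restricted_content D s A = 0"
  shows "restricted_dim D A \<le> a"
proof (rule ccontr)
  assume "\<not> restricted_dim D A \<le> a"
  then obtain s where s: "a < ereal s" "ereal s < restricted_dim D A"
    using ereal_dense2[of a] by (auto simp: not_le)
  then have "0 < s"
    using \<open>0 \<le> a\<close> by (cases a) auto
  then show False
    using restricted_dim_le[of s D A] assms(2)[of s] s by auto
qed

lemma restricted_dim_mono:
  assumes "A \<subseteq> B"
  shows "restricted_dim D A \<le> restricted_dim D B"
proof -
  have "restricted_content D s A = 0" if "restricted_content D s B = 0" for s
    using restricted_content_mono[OF assms, of D s] that by simp
  then show ?thesis
    unfolding restricted_dim_def by (intro INF_superset_mono) auto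
qed

lemma restricted_dim_UN:
  fixes A :: "nat \<Rightarrow> 'a::metric_space set"
  assumes D: "D \<in> diameter_families"
  shows "restricted_dim D (\<Union>i. A i) = (SUP i. restricted_dim D (A i))"
proof (rule antisym)
  show "restricted_dim D (\<Union>i. A i) \<le> (SUP i. restricted_dim D (A i))"
  proof (rule restricted_dim_leI)
    show "0 \<le> (SUP i. restricted_dim D (A i))"
      by (rule SUP_upper2[of 0 UNIV]) (auto simp: restricted_dim_nonneg)
    fix s assume s: "(SUP i. restricted_dim D (A i)) < ereal s"
    have "restricted_dim D (A i) < ereal s" for i
      by (rule le_less_trans[OF SUP_upper s]) simp
    then show "restricted_content D s (\<Union>i. A i) = 0"
      by (intro restricted_content_UN_eq_0 restricted_content_eq_0_above[OF D])
  qed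
  show "(SUP i. restricted_dim D (A i)) \<le> restricted_dim D (\<Union>i. A i)"
    by (intro SUP_least restricted_dim_mono) blast
qed

text \<open>The image of a set of diameter \<open>d\<close> has diameter at most \<open>L * d\<close>, which need not lie in \<open>D\<close>; but it
  splits into a number of sets of diameter at most \<open>d\<close> that depends only on \<open>L\<close> and the dimension, and
  \<open>d\<close> itself lies in \<open>D\<close>.\<close>

lemma restricted_content_lipschitz_image_eq_0:
  fixes f :: "'a::metric_space \<Rightarrow> 'b::euclidean_space"
  assumes D: "D \<in> diameter_families" and "0 < s" and lip: "L-lipschitz_on UNIV f"
    and A: "restricted_content D s A = 0"
  shows "restricted_content D s (f ` A) = 0"
proof -
  have "0 \<le> L"
    using lip by (rule lipschitz_on_nonneg)
  obtain K :: nat where K: "0 < K" "real DIM('b) * (L + 1) \<le> K"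
    using ex_scale_factor by blast
  define N where "N = (2 * K + 1) ^ DIM('b)"
  have image: "restricted_content D s (f ` E) \<le> of_nat N * ennreal (diameter E powr s)"
    if E: "bounded E" "diameter E \<in> D" for E
  proof -
    let ?d = "diameter E"
    have "0 < ?d"
      using D E(2) by (auto simp: diameter_families_def)
    have d: "dist u v \<le> (L + 1) * ?d" if "u \<in> f ` E" "v \<in> f ` E" for u v
    proof -
      obtain x y where xy: "x \<in> E" "y \<in> E" "u = f x" "v = f y"
        using \<open>u \<in> f ` E\<close> \<open>v \<in> f ` E\<close> by blast
      have "dist u v \<le> L * dist x y"
        using lipschitz_onD[OF lip] xy by simp
      also have "\<dots> \<le> (L + 1) * ?d"
        using \<open>0 \<le> L\<close> diameter_bounded_bound[OF E(1) xy(1,2)] by (intro mult_mono) auto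
      finally show ?thesis .
    qed
    have b: "bounded (f ` E)"
      unfolding bounded_two_points using d by blast
    moreover have "diameter (f ` E) \<le> (L + 1) * ?d"
      using \<open>0 \<le> L\<close> \<open>0 < ?d\<close> by (intro diameter_le_dist d) auto
    moreover have "0 < (L + 1) * ?d"
      using \<open>0 \<le> L\<close> \<open>0 < ?d\<close> by simp
    moreover have "real DIM('b) * ((L + 1) * ?d) / real K \<le> ?d"
      using mult_right_mono[OF K(2), of ?d] \<open>0 < ?d\<close> K(1) by (simp add: pos_divide_le_eq mult_ac)
    ultimately have "covering_number ?d (f ` E) \<le> N"
      unfolding N_def using covering_number_le_scale K(1) by blast
    then have "of_nat (covering_number ?d (f ` E)) * ennreal (?d powr s) \<le> of_nat N * ennreal (?d powr s)"
      by (intro mult_right_mono) auto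
    with restricted_content_le_covering_number[OF D \<open>0 < s\<close> b E(2)] show ?thesis
      by (rule order_trans)
  qed
  have "0 < N"
    by (simp add: N_def)
  have "restricted_content D s (f ` A) \<le> 0 + ennreal e" if e: "0 < e" for e
  proof -
    have "restricted_content D s A < ennreal (e / N)"
      using A e \<open>0 < N\<close> by simp
    then obtain E :: "nat \<Rightarrow> 'a set" where E: "A \<subseteq> (\<Union>i. E i)" "\<And>i. bounded (E i)"
      "\<And>i. diameter (E i) \<in> D" "(\<Sum>i. ennreal (diameter (E i) powr s)) < ennreal (e / N)"
      by (rule restricted_content_lessE) blast
    have "f ` A \<subseteq> (\<Union>i. f ` E i)"
      using E(1) by blast
    then have "restricted_content D s (f ` A) \<le> restricted_content D s (\<Union>i. f ` E i)"
      by (rule restricted_content_mono)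
    also have "\<dots> \<le> (\<Sum>i. restricted_content D s (f ` E i))"
      by (rule restricted_content_UN_le)
    also have "\<dots> \<le> (\<Sum>i. of_nat N * ennreal (diameter (E i) powr s))"
      using image E by (intro suminf_le) auto
    also have "\<dots> = of_nat N * (\<Sum>i. ennreal (diameter (E i) powr s))"
      by simp
    also have "\<dots> \<le> of_nat N * ennreal (e / N)"
      using E(4) by (intro mult_left_mono) auto
    also have "\<dots> = ennreal (real N * (e / N))"
      using e by (simp add: ennreal_of_nat_eq_real_of_nat flip: ennreal_mult)
    also have "\<dots> = ennreal e"
      using \<open>0 < N\<close> by simp
    finally show ?thesis
      by simp
  qed
  from ennreal_le_epsilon[OF this] show ?thesis
    by simp
qed

lemma restricted_dim_lipschitz_image:
  fixes f :: "'a::metric_space \<Rightarrow> 'b::euclidean_space"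
  assumes D: "D \<in> diameter_families" and "L-lipschitz_on UNIV f"
  shows "restricted_dim D (f ` A) \<le> restricted_dim D A"
  using restricted_content_lipschitz_image_eq_0[OF D _ assms(2)] restricted_content_eq_0_above[OF D]
  by (intro restricted_dim_leI restricted_dim_nonneg) blast

text \<open>A \<open>G\<^sub>\<delta>\<close> hull that works for one exponent above the dimension is not enough. The \<open>n\<close>-th open set
  is small for an exponent within \<open>1 / (n + 1)\<close> of the dimension, and small content stays small when the
  exponent grows.\<close>

lemma gdelta_hull_restricted_dim:
  fixes E :: "'a::metric_space set"
  assumes D: "D \<in> diameter_families"
  obtains B where "gdelta_in euclidean B" "E \<subseteq> B" "restricted_dim D B = restricted_dim D E"
proof (cases "restricted_dim D E = \<infinity>")
  case True
  then have "restricted_dim D (UNIV :: 'a set) = restricted_dim D E"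
    using restricted_dim_mono[of E UNIV D] by simp
  moreover have "gdelta_in euclidean (UNIV :: 'a set)"
    using gdelta_in_topspace[of "euclidean :: 'a topology"] by simp
  ultimately show thesis
    using that[of UNIV] by simp
next
  case False
  then obtain d where d: "restricted_dim D E = ereal d" "0 \<le> d"
    using restricted_dim_nonneg[of D E] by (cases "restricted_dim D E") auto
  define s where "s n = d + inverse (real (Suc n))" for n
  have s: "0 < s n" "d < s n" for n
    using \<open>0 \<le> d\<close> by (auto simp: s_def intro: add_nonneg_pos)
  have "\<exists>U. open U \<and> E \<subseteq> U \<and> restricted_content D (s n) U \<le> ennreal (inverse (real (Suc n)))" for n
  proof -
    have "restricted_content D (s n) E < ennreal (inverse (real (Suc n)))"
      using restricted_content_eq_0_above[OF D, of E "s n"] d s by simp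
    then obtain U :: "nat \<Rightarrow> 'a set" where U: "E \<subseteq> (\<Union>i. U i)" "\<And>i. open (U i)"
      "\<And>i. bounded (U i)" "\<And>i. diameter (U i) \<in> D"
      "(\<Sum>i. ennreal (diameter (U i) powr s n)) < ennreal (inverse (real (Suc n)))"
      by (rule restricted_content_open_cover[OF D s(1)]) blast
    have "restricted_content D (s n) (\<Union>i. U i) \<le> ennreal (inverse (real (Suc n)))"
      by (rule order_trans[OF restricted_content_upper[OF subset_refl U(3,4)] less_imp_le[OF U(5)]])
    moreover have "open (\<Union>i. U i)"
      using U(2) by (intro open_UN) simp
    ultimately show ?thesis
      using U(1) by (intro exI[of _ "\<Union>i. U i"] conjI)
  qed
  then obtain U where U: "\<And>n. open (U n)" "\<And>n. E \<subseteq> U n"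
    "\<And>n. restricted_content D (s n) (U n) \<le> ennreal (inverse (real (Suc n)))"
    by metis
  define B where "B = (\<Inter>n. U n)"
  have "gdelta_in euclidean B"
    unfolding B_def using U(1) by (intro gdelta_in_Inter open_imp_gdelta_in) auto
  moreover have "E \<subseteq> B"
    using U(2) by (auto simp: B_def)
  moreover have "restricted_dim D B \<le> ereal d"
  proof (rule restricted_dim_leI)
    fix t assume "ereal d < ereal t"
    then obtain m where m: "inverse (real (Suc m)) < t - d"
      using reals_Archimedean[of "t - d"] by auto
    have "restricted_content D t B \<le> 0 + ennreal e" if e: "0 < e" for e
    proof -
      obtain k where k: "inverse (real (Suc k)) < min e 1"
        using reals_Archimedean[of "min e 1"] e by auto
      define n where "n = max m k"
      have "inverse (real (Suc n)) \<le> inverse (real (Suc m))" "inverse (real (Suc n)) \<le> inverse (real (Suc k))"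
        by (auto simp: n_def intro!: le_imp_inverse_le)
      then have n: "inverse (real (Suc n)) < t - d" "inverse (real (Suc n)) < e" "inverse (real (Suc n)) < 1"
        using m k by linarith+
      have "restricted_content D (s n) (U n) < 1"
        using n(3) by (intro le_less_trans[OF U(3)]) (simp add: ennreal_less_iff flip: ennreal_1)
      then have t: "restricted_content D t (U n) \<le> restricted_content D (s n) (U n)"
        using s[of n] n(1) by (intro restricted_content_antimono[OF D]) (auto simp: s_def)
      have "B \<subseteq> U n"
        by (auto simp: B_def)
      then have "restricted_content D t B \<le> restricted_content D t (U n)"
        by (rule restricted_content_mono)
      also note t
      also note U(3)
      also have "ennreal (inverse (real (Suc n))) \<le> ennreal e"
        using n(2) by (intro ennreal_leI) simp
      finally show ?thesis
        by simp
    qed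
    from ennreal_le_epsilon[OF this] show "restricted_content D t B = 0"
      by simp
  qed (use d in simp)
  ultimately show thesis
    using that restricted_dim_mono[of E B D] d by (simp add: antisym)
qed

section \<open>Comparison with Hausdorff and packing dimension\<close>

text \<open>If the total cost of a cover is small, then so is every single member, and the cover becomes admissible
  for the Hausdorff premeasure at any prescribed scale.\<close>

lemma hausdorff_measure_eq_0_of_restricted_content:
  assumes D: "D \<in> diameter_families" and "0 \<le> s" "restricted_content D s A = 0"
  shows "hausdorff_measure s A = 0"
proof -
  have "0 < s"
    using restricted_content_0_neq_0[OF D, of A] assms(2,3) by (cases "s = 0") auto
  have "hausdorff_premeasure \<delta> s A \<le> 0 + ennreal e" if \<delta>: "0 < \<delta>" and e: "0 < e" for \<delta> e
  proof -
    have "restricted_content D s A < ennreal (min e (\<delta> powr s))"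
      using assms(3) \<delta> e by simp
    then obtain E :: "nat \<Rightarrow> 'a set" where E: "A \<subseteq> (\<Union>i. E i)" "\<And>i. bounded (E i)"
      "\<And>i. diameter (E i) \<in> D" "(\<Sum>i. ennreal (diameter (E i) powr s)) < ennreal (min e (\<delta> powr s))"
      by (rule restricted_content_lessE) blast
    have "diameter (E i) \<le> \<delta>" for i
    proof (rule ccontr)
      assume "\<not> diameter (E i) \<le> \<delta>"
      then have "\<delta> powr s \<le> diameter (E i) powr s"
        using \<delta> \<open>0 < s\<close> by (intro powr_mono2) auto
      then show False
        using ennreal_suminf_lessD[OF E(4), of i] by (simp add: ennreal_less_iff)
    qed
    then have "hausdorff_premeasure \<delta> s A \<le> (\<Sum>i. ennreal (diameter_power s (E i)))"
      unfolding hausdorff_premeasure_def using E(1,2) by (intro INF_lower) auto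
    also have "(\<lambda>i. diameter_power s (E i)) = (\<lambda>i. diameter (E i) powr s)"
      using \<open>0 < s\<close> by (auto simp: diameter_power_def)
    also have "(\<Sum>i. ennreal (diameter (E i) powr s)) \<le> ennreal (min e (\<delta> powr s))"
      using E(4) by simp
    also have "\<dots> \<le> ennreal e"
      by (intro ennreal_leI) simp
    finally show ?thesis
      by simp
  qed
  then have "hausdorff_premeasure \<delta> s A = 0" if "0 < \<delta>" for \<delta>
    using ennreal_le_epsilon[of 0 "hausdorff_premeasure \<delta> s A"] that by simp
  then show ?thesis
    by (simp add: hausdorff_measure_def)
qed

lemma hausdorff_dim_le_restricted_dim:
  assumes "D \<in> diameter_families"
  shows "hausdorff_dim A \<le> restricted_dim D A"
  unfolding hausdorff_dim_def restricted_dim_def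
  using hausdorff_measure_eq_0_of_restricted_content[OF assms] by (intro INF_superset_mono) auto

lemma upper_box_dim_nonneg: "0 \<le> upper_box_dim A"
proof -
  have "0 \<le> ereal (ln (real (covering_number d A)) / - ln d)" if "0 < d" "d < 1" for d
  proof -
    have "0 \<le> ln (real (covering_number d A))"
      by (cases "covering_number d A") auto
    moreover have "0 \<le> - ln d"
      using that by simp
    ultimately show ?thesis
      by (simp only: ereal_less_eq zero_ereal_def divide_nonneg_nonneg)
  qed
  then have "\<forall>\<^sub>F d in at_right 0. 0 \<le> ereal (ln (real (covering_number d A)) / - ln d)"
    unfolding eventually_at_right_field by (intro exI[of _ 1]) auto
  then show ?thesis
    unfolding upper_box_dim_def by (intro le_Limsup) auto
qed

lemma restricted_dim_le_upper_box_dim: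
  fixes A :: "'a::euclidean_space set"
  assumes D: "D \<in> diameter_families" and "bounded A"
  shows "restricted_dim D A \<le> upper_box_dim A"
proof (rule restricted_dim_leI[OF upper_box_dim_nonneg])
  fix s :: real assume s: "0 < s" "upper_box_dim A < ereal s"
  then obtain t where t: "upper_box_dim A < ereal t" "ereal t < ereal s"
    using ereal_dense2 by blast
  then have "\<forall>\<^sub>F d in at_right 0. ereal (ln (real (covering_number d A)) / - ln d) < ereal t"
    unfolding upper_box_dim_def by (intro Limsup_lessD) auto
  then obtain b where b: "0 < b"
    "\<And>d. 0 < d \<Longrightarrow> d < b \<Longrightarrow> ln (real (covering_number d A)) / - ln d < t"
    unfolding eventually_at_right_field by auto
  have "real (covering_number d A) \<le> 1 * d powr - t" if d: "0 < d" "d < min b 1" for d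
  proof (cases "covering_number d A = 0")
    case False
    have "0 < - ln d"
      using d by simp
    then have "ln (real (covering_number d A)) < t * - ln d"
      using b(2)[of d] d by (simp only: pos_divide_less_eq)
    then have "exp (ln (real (covering_number d A))) \<le> exp (- t * ln d)"
      by simp
    then show ?thesis
      using False d by (simp add: powr_def)
  qed simp
  then show "restricted_content D s A = 0"
    using s t b(1)
    by (intro restricted_content_eq_0_of_covering_number[OF D \<open>bounded A\<close>, of s t "min b 1" 1]) auto
qed

lemma restricted_dim_le_packing_dim:
  fixes A :: "'a::euclidean_space set"
  assumes D: "D \<in> diameter_families"
  shows "restricted_dim D A \<le> packing_dim A"
  unfolding packing_dim_def
proof (rule INF_greatest)
  fix X :: "nat \<Rightarrow> 'a set"
  assume "X \<in> {X. A = (\<Union>i. X i) \<and> (\<forall>i. bounded (X i))}"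
  then have X: "A = (\<Union>i. X i)" "\<And>i. bounded (X i)"
    by auto
  show "restricted_dim D A \<le> (SUP i. upper_box_dim (X i))"
    unfolding X(1) restricted_dim_UN[OF D]
    by (intro SUP_mono') (rule restricted_dim_le_upper_box_dim[OF D X(2)])
qed

lemma restricted_dim_le_DIM:
  fixes A :: "'a::euclidean_space set"
  assumes D: "D \<in> diameter_families"
  shows "restricted_dim D A \<le> ereal DIM('a)"
proof -
  have "restricted_dim D (ball (0 :: 'a) (real i)) \<le> ereal DIM('a)" for i
  proof (rule restricted_dim_leI)
    fix s :: real assume s: "0 < s" "ereal DIM('a) < ereal s"
    obtain C where "\<And>d. 0 < d \<Longrightarrow> d < 1 \<Longrightarrow>
        real (covering_number d (ball (0 :: 'a) (real i))) \<le> C * d powr - real DIM('a)"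
      by (rule covering_number_le_powr_DIM[OF bounded_ball[of "0 :: 'a" "real i"]]) (rule that)
    then show "restricted_content D s (ball (0 :: 'a) (real i)) = 0"
      using s by (intro restricted_content_eq_0_of_covering_number[OF D, of _ s "real DIM('a)" 1 C]) auto
  qed simp
  then have "(SUP i. restricted_dim D (ball (0 :: 'a) (real i))) \<le> ereal DIM('a)"
    by (intro SUP_least)
  moreover have "A \<subseteq> (\<Union>i. ball 0 (real i))"
    using reals_Archimedean2 by auto
  then have "restricted_dim D A \<le> (SUP i. restricted_dim D (ball (0 :: 'a) (real i)))"
    using restricted_dim_mono restricted_dim_UN[OF D, of "\<lambda>i. ball (0 :: 'a) (real i)"] by metis
  ultimately show ?thesis
    by (rule order_trans[rotated])
qed

section \<open>Self-similar sets\<close>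

text \<open>This takes the place of the mass distribution principle. Suppose that \<open>S\<close> contains at least \<open>c\<close> to the
  power \<open>-t\<close> copies of itself, shrunk by a factor no smaller than \<open>c\<close> and at mutual distance at least
  \<open>\<delta>\<close>. A member of a cover of cost less than \<open>\<delta>\<close> to the power \<open>t\<close> is too small to meet two copies.
  The members meeting the cheapest copy, pulled back to \<open>S\<close>, form a cover of \<open>S\<close> that costs no
  more and has fewer members. So no such finite cover exists.\<close>

lemma separated_copies_cover_sum_ge:
  fixes S :: "'a::metric_space set" and U :: "'j \<Rightarrow> 'a set"
  assumes "S \<noteq> {}" "finite I" "2 \<le> card I" "0 < t" "0 < c" "1 \<le> real (card I) * c powr t" "0 < \<delta>"
    and into: "\<And>i x. i \<in> I \<Longrightarrow> x \<in> S \<Longrightarrow> g i x \<in> S"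
    and expand: "\<And>i x y. i \<in> I \<Longrightarrow> x \<in> S \<Longrightarrow> y \<in> S \<Longrightarrow> c * dist x y \<le> dist (g i x) (g i y)"
    and sep: "\<And>i j x y. i \<in> I \<Longrightarrow> j \<in> I \<Longrightarrow> i \<noteq> j \<Longrightarrow> x \<in> S \<Longrightarrow> y \<in> S \<Longrightarrow> \<delta> \<le> dist (g i x) (g j y)"
    and "finite J" "S \<subseteq> (\<Union>j\<in>J. U j)" "\<And>j. j \<in> J \<Longrightarrow> bounded (U j)"
  shows "\<delta> powr t \<le> (\<Sum>j\<in>J. diameter (U j) powr t)"
  using assms(11-13)
proof (induction "card J" arbitrary: J U rule: less_induct)
  case less
  note cover = less.prems
  define w where "w j = diameter (U j) powr t" for j
  show ?case
  proof (rule ccontr)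
    assume "\<not> ?thesis"
    then have small: "sum w J < \<delta> powr t"
      by (simp add: w_def)
    have diam: "diameter (U j) < \<delta>" if "j \<in> J" for j
    proof (rule ccontr)
      assume "\<not> diameter (U j) < \<delta>"
      then have "\<delta> powr t \<le> w j"
        unfolding w_def using \<open>0 < t\<close> \<open>0 < \<delta>\<close> by (intro powr_mono2) auto
      also have "\<dots> \<le> sum w J"
        using that cover(1) by (intro member_le_sum) (auto simp: w_def)
      finally show False
        using small by simp
    qed
    define J' where "J' i = {j \<in> J. \<exists>x\<in>S. g i x \<in> U j}" for i
    have fin: "finite (J' i)" for i
      using cover(1) by (simp add: J'_def)
    have disj: "J' i \<inter> J' k = {}" if "i \<in> I" "k \<in> I" "i \<noteq> k" for i k
    proof (rule ccontr)
      assume "J' i \<inter> J' k \<noteq> {}"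
      then obtain j x y where j: "j \<in> J" "x \<in> S" "y \<in> S" "g i x \<in> U j" "g k y \<in> U j"
        by (auto simp: J'_def)
      then have "dist (g i x) (g k y) \<le> diameter (U j)"
        using cover(3) by (intro diameter_bounded_bound) auto
      then show False
        using diam[OF j(1)] sep[OF that j(2,3)] by simp
    qed
    have nonempty: "J' i \<noteq> {}" if "i \<in> I" for i
    proof -
      obtain x where "x \<in> S"
        using \<open>S \<noteq> {}\<close> by blast
      moreover from this have "g i x \<in> S"
        using into that by blast
      ultimately obtain j where "j \<in> J" "x \<in> S" "g i x \<in> U j"
        using cover(2) by blast
      then have "j \<in> J' i"
        by (auto simp: J'_def)
      then show ?thesis
        by blast
    qed
    have "I \<noteq> {}"
      using assms(3) by auto
    have "\<exists>i\<in>I. real (card I) * sum w (J' i) \<le> sum w J"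
    proof (rule ccontr)
      assume "\<not> ?thesis"
      then have "(\<Sum>i\<in>I. sum w J) < (\<Sum>i\<in>I. real (card I) * sum w (J' i))"
        using \<open>I \<noteq> {}\<close> \<open>finite I\<close> by (intro sum_strict_mono) (auto simp: not_le)
      also have "\<dots> = real (card I) * (\<Sum>i\<in>I. sum w (J' i))"
        by (simp add: sum_distrib_left)
      also have "(\<Sum>i\<in>I. sum w (J' i)) = sum w (\<Union>i\<in>I. J' i)"
        using \<open>finite I\<close> fin disj by (intro sum.UNION_disjoint[symmetric]) auto
      also have "real (card I) * \<dots> \<le> real (card I) * sum w J"
        using cover(1) by (intro mult_left_mono sum_mono2) (auto simp: J'_def w_def)
      finally show False
        by simp
    qed
    then obtain i where i: "i \<in> I" "real (card I) * sum w (J' i) \<le> sum w J"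
      by blast
    obtain k where k: "k \<in> I" "k \<noteq> i"
    proof -
      have "\<not> I \<subseteq> {i}"
        using card_mono[of "{i}" I] assms(3) by auto
      then show thesis
        using that by blast
    qed
    have "J' i \<subseteq> J" "J' k \<subseteq> J"
      by (auto simp: J'_def)
    then have "J' i \<subset> J"
      using nonempty[OF k(1)] disj[OF k(1) i(1) k(2)] by blast
    then have card: "card (J' i) < card J"
      using cover(1) by (intro psubset_card_mono)
    define V where "V j = {x \<in> S. g i x \<in> U j}" for j
    have dV: "dist x y \<le> diameter (U j) / c" if "j \<in> J" "x \<in> V j" "y \<in> V j" for j x y
    proof -
      have "c * dist x y \<le> dist (g i x) (g i y)"
        using that i(1) by (intro expand) (auto simp: V_def)
      also have "\<dots> \<le> diameter (U j)"
        using that cover(3) by (intro diameter_bounded_bound) (auto simp: V_def)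
      finally show ?thesis
        using \<open>0 < c\<close> by (simp add: pos_le_divide_eq mult.commute)
    qed
    have bV: "bounded (V j)" if "j \<in> J" for j
      unfolding bounded_two_points using dV[OF that] by blast
    have diamV: "diameter (V j) powr t \<le> w j / c powr t" if "j \<in> J" for j
    proof -
      have "0 \<le> diameter (U j) / c"
        using diameter_ge_0[OF cover(3)[OF that]] \<open>0 < c\<close> by simp
      then have "diameter (V j) \<le> diameter (U j) / c"
        using dV[OF that] by (rule diameter_le_dist)
      then have "diameter (V j) powr t \<le> (diameter (U j) / c) powr t"
        using bV[OF that] diameter_ge_0 \<open>0 < t\<close> by (intro powr_mono2) auto
      then show ?thesis
        by (simp add: w_def powr_divide)
    qed
    have "S \<subseteq> (\<Union>j\<in>J' i. V j)"
    proof
      fix x assume "x \<in> S"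
      moreover from this have "g i x \<in> S"
        using into i(1) by blast
      ultimately obtain j where "j \<in> J" "x \<in> S" "g i x \<in> U j"
        using cover(2) by blast
      then have "j \<in> J' i" "x \<in> V j"
        by (auto simp: J'_def V_def)
      then show "x \<in> (\<Union>j\<in>J' i. V j)"
        by blast
    qed
    moreover have "bounded (V j)" if "j \<in> J' i" for j
      using bV that by (simp add: J'_def)
    ultimately have "\<delta> powr t \<le> (\<Sum>j\<in>J' i. diameter (V j) powr t)"
      by (rule less.hyps[OF card fin])
    also have "\<dots> \<le> (\<Sum>j\<in>J' i. w j / c powr t)"
      by (intro sum_mono diamV) (simp add: J'_def)
    also have "\<dots> = sum w (J' i) / c powr t"
      by (simp add: sum_divide_distrib)
    also have "\<dots> \<le> real (card I) * sum w (J' i)"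
    proof -
      have "1 * sum w (J' i) \<le> real (card I) * c powr t * sum w (J' i)"
        using assms(6) by (intro mult_right_mono sum_nonneg) (auto simp: w_def)
      then show ?thesis
        using \<open>0 < c\<close> by (simp add: pos_divide_le_eq mult_ac)
    qed
    also note i(2)
    finally show False
      using small by simp
  qed
qed

lemma hausdorff_dim_less_finite_cover:
  fixes S :: "'a::metric_space set"
  assumes "compact S" "hausdorff_dim S < ereal t" "0 < e"
  obtains J :: "nat set" and U where "finite J" "S \<subseteq> (\<Union>j\<in>J. U j)" "\<And>j. j \<in> J \<Longrightarrow> bounded (U j)"
    "(\<Sum>j\<in>J. diameter (U j) powr t) < e"
proof -
  obtain r where r: "0 \<le> r" "hausdorff_measure r S = 0" "r < t"
    using assms(2) unfolding hausdorff_dim_def INF_less_iff by auto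
  have "hausdorff_premeasure 1 r S \<le> hausdorff_measure r S"
    unfolding hausdorff_measure_def by (rule SUP_upper) simp
  then have "hausdorff_premeasure 1 r S < ennreal (e / 2)"
    using r(2) \<open>0 < e\<close> by simp
  then obtain E :: "nat \<Rightarrow> 'a set" where E: "S \<subseteq> (\<Union>i. E i)" "\<And>i. bounded (E i)" "\<And>i. diameter (E i) \<le> 1"
    "(\<Sum>i. ennreal (diameter_power r (E i))) < ennreal (e / 2)"
    unfolding hausdorff_premeasure_def INF_less_iff by blast
  have "\<exists>U. open U \<and> E i \<subseteq> U \<and> bounded U \<and>
      diameter U powr t \<le> diameter_power r (E i) + e / 2 * (1 / 2) ^ Suc i" for i
  proof -
    have "0 < e / 2 * (1 / 2) ^ Suc i" "0 < t"
      using \<open>0 < e\<close> r by auto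
    then obtain U where U: "open U" "E i \<subseteq> U" "bounded U"
      "diameter U powr t \<le> diameter (E i) powr t + e / 2 * (1 / 2) ^ Suc i"
      by (rule open_thickening_powr[OF E(2)[of i] _ _ zero_less_one]) (rule that)
    have "0 \<le> diameter (E i)"
      using E(2) diameter_ge_0 by blast
    then have "diameter (E i) powr t \<le> diameter_power r (E i)"
      using E(3)[of i] r \<open>0 < t\<close> by (auto simp: diameter_power_def intro!: powr_mono' powr_le1)
    then show ?thesis
      using U by (intro exI[of _ U]) auto
  qed
  then obtain U :: "nat \<Rightarrow> 'a set" where U: "\<And>i. open (U i)" "\<And>i. E i \<subseteq> U i" "\<And>i. bounded (U i)"
    "\<And>i. diameter (U i) powr t \<le> diameter_power r (E i) + e / 2 * (1 / 2) ^ Suc i"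
    by metis
  have "S \<subseteq> (\<Union>i\<in>UNIV. U i)"
    using E(1) U(2) by blast
  then obtain J where J: "finite J" "S \<subseteq> (\<Union>j\<in>J. U j)"
    by (rule compactE_image[where f = U and C = UNIV, OF assms(1) U(1)]) blast
  have dp: "0 \<le> diameter_power r (E i)" for i
    by (simp add: diameter_power_def)
  have "ennreal (\<Sum>j\<in>J. diameter (U j) powr t) = (\<Sum>j\<in>J. ennreal (diameter (U j) powr t))"
    by simp
  also have "\<dots> \<le> (\<Sum>i. ennreal (diameter (U i) powr t))"
    using J(1) by (intro sum_le_suminf) auto
  also have "\<dots> \<le> (\<Sum>i. ennreal (e / 2 * (1 / 2) ^ Suc i) + ennreal (diameter_power r (E i)))"
  proof (rule suminf_le)
    fix i
    have "ennreal (diameter (U i) powr t) \<le> ennreal (e / 2 * (1 / 2) ^ Suc i + diameter_power r (E i))"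
      using U(4)[of i] by (intro ennreal_leI) linarith
    then show "ennreal (diameter (U i) powr t) \<le>
        ennreal (e / 2 * (1 / 2) ^ Suc i) + ennreal (diameter_power r (E i))"
      using \<open>0 < e\<close> dp by (subst (asm) ennreal_plus) auto
  qed auto
  also have "\<dots> = (\<Sum>i. ennreal (e / 2 * (1 / 2) ^ Suc i)) + (\<Sum>i. ennreal (diameter_power r (E i)))"
    by (rule suminf_add[symmetric]) auto
  also have "(\<Sum>i. ennreal (e / 2 * (1 / 2) ^ Suc i)) = ennreal (e / 2)"
    using \<open>0 < e\<close> by (intro suminf_geometric_ennreal) simp
  also have "ennreal (e / 2) + (\<Sum>i. ennreal (diameter_power r (E i))) < ennreal (e / 2) + ennreal (e / 2)"
    unfolding ennreal_add_left_cancel_less using E(4) by simp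
  also have "\<dots> = ennreal e"
    using \<open>0 < e\<close> by (simp flip: ennreal_plus)
  finally have "(\<Sum>j\<in>J. diameter (U j) powr t) < e"
    by (simp add: ennreal_less_iff sum_nonneg)
  then show thesis
    by (rule that[OF J U(3)])
qed

text \<open>Composing the similarities along a coding of \<open>x\<close> multiplies the ratio by at least \<open>a\<close> in each step, where \<open>a\<close>
  is the least of their ratios. So the first ratio that does not exceed \<open>\<rho>\<close> is still at least \<open>a * \<rho>\<close>.\<close>

lemma self_similar_copies:
  fixes S :: "'a::metric_space set"
  assumes "self_similar S"
  obtains a where "0 < a" "a \<le> 1"
    "\<And>x \<rho>. x \<in> S \<Longrightarrow> 0 < \<rho> \<Longrightarrow> \<rho> \<le> 1 \<Longrightarrow> \<exists>g c. g ` S \<subseteq> S \<and> x \<in> g ` S \<and> a * \<rho> \<le> c \<and> c \<le> \<rho> \<and>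
      (\<forall>u v. dist (g u) (g v) = c * dist u v)"
proof -
  obtain m :: nat and f where f: "\<And>i. i < m \<Longrightarrow> contracting_similarity (f i)" "S = (\<Union>i<m. f i ` S)" "S \<noteq> {}"
    using assms unfolding self_similar_def by blast
  have "m \<noteq> 0"
  proof
    assume "m = 0"
    then show False using f(2,3) by simp
  qed
  have "\<forall>i. \<exists>r. i < m \<longrightarrow> 0 < r \<and> r < 1 \<and> (\<forall>x y. dist (f i x) (f i y) = r * dist x y)"
    using f(1) unfolding contracting_similarity_def by blast
  then obtain r where r: "\<And>i. i < m \<Longrightarrow> 0 < r i \<and> r i < 1 \<and> (\<forall>x y. dist (f i x) (f i y) = r i * dist x y)"
    by metis
  define a where "a = Min (r ` {..<m})"
  define b where "b = Max (r ` {..<m})"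
  have fin: "finite (r ` {..<m})" "r ` {..<m} \<noteq> {}"
    using \<open>m \<noteq> 0\<close> by auto
  have a: "0 < a" "a \<le> 1" and b: "0 < b" "b < 1"
    using Min_in[OF fin] Max_in[OF fin] r by (force simp: a_def b_def)+
  have ab: "a \<le> r i" "r i \<le> b" if "i < m" for i
    using that fin by (auto simp: a_def b_def)
  have *: "\<exists>g c. g ` S \<subseteq> S \<and> x \<in> g ` S \<and> a * \<rho> \<le> c \<and> c \<le> \<rho> \<and> (\<forall>u v. dist (g u) (g v) = c * dist u v)"
    if "x \<in> S" "b ^ n \<le> \<rho>" "\<rho> \<le> 1" for n x \<rho>
    using that
  proof (induction n arbitrary: x \<rho>)
    case 0
    then have "\<rho> = 1" by simp
    then show ?case
      using 0 a by (intro exI[of _ id] exI[of _ 1]) auto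
  next
    case (Suc n)
    have "0 < \<rho>"
      using Suc.prems(2) b(1) by (meson less_le_trans zero_less_power)
    obtain i y where iy: "i < m" "y \<in> S" "x = f i y"
      using Suc.prems(1) f(2) by blast
    have fS: "f i ` S \<subseteq> S"
      using f(2) iy(1) by blast
    note ri = r[OF iy(1)] and abi = ab[OF iy(1)]
    show ?case
    proof (cases "r i \<le> \<rho>")
      case True
      have "a * \<rho> \<le> r i"
        using mult_left_le[of \<rho> a] Suc.prems(3) a abi(1) by linarith
      then show ?thesis
        using True fS iy ri by (intro exI[of _ "f i"] exI[of _ "r i"]) blast
    next
      case False
      have "b ^ n * r i \<le> b ^ n * b"
        using abi b(1) by (intro mult_left_mono) auto
      also have "\<dots> \<le> \<rho>"
        using Suc.prems(2) by (simp add: mult.commute)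
      finally have "b ^ n \<le> \<rho> / r i" "\<rho> / r i \<le> 1"
        using False ri by (auto simp: pos_le_divide_eq)
      from Suc.IH[OF iy(2) this] obtain g c where g: "g ` S \<subseteq> S" "y \<in> g ` S" "a * (\<rho> / r i) \<le> c"
        "c \<le> \<rho> / r i" "\<And>u v. dist (g u) (g v) = c * dist u v"
        by blast
      have "(f i \<circ> g) ` S \<subseteq> S" "x \<in> (f i \<circ> g) ` S"
        using g(1,2) fS iy(3) by (auto simp: image_comp[symmetric])
      moreover have "a * \<rho> \<le> r i * c" "r i * c \<le> \<rho>"
        using g(3,4) ri by (auto simp: pos_divide_le_eq pos_le_divide_eq mult_ac)
      moreover have "\<forall>u v. dist ((f i \<circ> g) u) ((f i \<circ> g) v) = r i * c * dist u v"
        using g(5) ri by simp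
      ultimately show ?thesis
        by blast
    qed
  qed
  show thesis
  proof (rule that[OF a])
    fix x \<rho> assume "x \<in> S" "(0::real) < \<rho>" "\<rho> \<le> 1"
    moreover obtain n where "b ^ n < \<rho>"
      using real_arch_pow_inv[OF \<open>0 < \<rho>\<close> b(2)] by blast
    ultimately show "\<exists>g c. g ` S \<subseteq> S \<and> x \<in> g ` S \<and> a * \<rho> \<le> c \<and> c \<le> \<rho> \<and>
        (\<forall>u v. dist (g u) (g v) = c * dist u v)"
      using *[of x n \<rho>] by simp
  qed
qed

text \<open>Although the pieces of \<open>S\<close> may overlap, the copies of \<open>S\<close> of comparable size around the points of a
  separated subset are separated from each other. If the subset were larger than the bound, these copies
  would force \<open>hausdorff_dim S \<ge> t\<close>.\<close>

lemma self_similar_card_separated_le: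
  fixes S :: "'a::metric_space set"
  assumes S: "self_similar S" and t: "hausdorff_dim S < ereal t" and M: "0 < M" "diameter S \<le> M"
  obtains a where "0 < a"
    "\<And>\<rho> X. 0 < \<rho> \<Longrightarrow> \<rho> \<le> 1 \<Longrightarrow> finite X \<Longrightarrow> X \<subseteq> S \<Longrightarrow>
      (\<And>x y. x \<in> X \<Longrightarrow> y \<in> X \<Longrightarrow> x \<noteq> y \<Longrightarrow> 3 * \<rho> * M \<le> dist x y) \<Longrightarrow> real (card X) \<le> (a * \<rho>) powr - t"
proof -
  have "compact S" "S \<noteq> {}"
    using S by (auto simp: self_similar_def)
  obtain r where "0 \<le> r" "r < t"
    using t unfolding hausdorff_dim_def INF_less_iff by auto
  then have "0 < t" by simp
  obtain a where a: "0 < a" "a \<le> 1" "\<And>x \<rho>. x \<in> S \<Longrightarrow> 0 < \<rho> \<Longrightarrow> \<rho> \<le> 1 \<Longrightarrow>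
      \<exists>g c. g ` S \<subseteq> S \<and> x \<in> g ` S \<and> a * \<rho> \<le> c \<and> c \<le> \<rho> \<and> (\<forall>u v. dist (g u) (g v) = c * dist u v)"
    by (rule self_similar_copies[OF S]) (rule that)
  have "real (card X) \<le> (a * \<rho>) powr - t"
    if \<rho>: "0 < \<rho>" "\<rho> \<le> 1" and X: "finite X" "X \<subseteq> S"
      and sepX: "\<And>x y. x \<in> X \<Longrightarrow> y \<in> X \<Longrightarrow> x \<noteq> y \<Longrightarrow> 3 * \<rho> * M \<le> dist x y" for \<rho> X
  proof (rule ccontr)
    assume "\<not> ?thesis"
    then have large: "(a * \<rho>) powr - t < real (card X)"
      by simp
    have a\<rho>: "0 < a * \<rho>" "a * \<rho> \<le> 1"
      using a \<rho> by (auto intro: mult_le_one)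
    have "1 \<le> (a * \<rho>) powr - t"
      using powr_mono'[of "- t" 0 "a * \<rho>"] a\<rho> a(1) \<rho>(1) \<open>0 < t\<close> by simp
    then have card2: "2 \<le> card X"
      using large by linarith
    have "(a * \<rho>) powr - t * (a * \<rho>) powr t \<le> real (card X) * (a * \<rho>) powr t"
      using large by (intro mult_right_mono) auto
    then have many: "1 \<le> real (card X) * (a * \<rho>) powr t"
      using a\<rho> a(1) \<rho>(1) by (simp flip: powr_add)
    have "\<forall>x. \<exists>g c. x \<in> X \<longrightarrow> g ` S \<subseteq> S \<and> x \<in> g ` S \<and> a * \<rho> \<le> c \<and> c \<le> \<rho> \<and>
        (\<forall>u v. dist (g u) (g v) = c * dist u v)"
      using a(3)[OF _ \<rho>] X(2) by blast
    then obtain g c where g: "\<And>x. x \<in> X \<Longrightarrow> g x ` S \<subseteq> S \<and> x \<in> g x ` S \<and> a * \<rho> \<le> c x \<and> c x \<le> \<rho> \<and>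
        (\<forall>u v. dist (g x u) (g x v) = c x * dist u v)"
      by metis
    have expand: "a * \<rho> * dist u v \<le> dist (g x u) (g x v)" if "x \<in> X" for x u v
      using g[OF that] by (simp add: mult_right_mono)
    \<comment> \<open>so a distance of \<open>3 * \<rho> * M\<close> between two points leaves \<open>\<rho> * M\<close> between their copies\<close>
    have near: "dist x (g x u) \<le> \<rho> * M" if x: "x \<in> X" and u: "u \<in> S" for x u
    proof -
      obtain p where p: "p \<in> S" "x = g x p"
        using g[OF x] by blast
      have "dist p u \<le> M"
        using diameter_bounded_bound[OF compact_imp_bounded[OF \<open>compact S\<close>] p(1) u] M(2) by simp
      then have "c x * dist p u \<le> \<rho> * M"
        using g[OF x] \<rho>(1) by (intro mult_mono) auto
      moreover have "dist x (g x u) = c x * dist p u"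
        using g[OF x] p(2) by metis
      ultimately show ?thesis
        by simp
    qed
    have sep: "\<rho> * M \<le> dist (g x u) (g y v)" if "x \<in> X" "y \<in> X" "x \<noteq> y" "u \<in> S" "v \<in> S" for x y u v
    proof -
      have "dist x y \<le> dist x (g x u) + dist (g x u) (g y v) + dist y (g y v)"
        using dist_triangle[of x y "g x u"] dist_triangle[of "g x u" y "g y v"]
        by (simp add: dist_commute)
      then show ?thesis
        using near[OF that(1,4)] near[OF that(2,5)] sepX[OF that(1-3)] by simp
    qed
    have "0 < (\<rho> * M) powr t"
      using \<rho>(1) M(1) by simp
    then obtain J :: "nat set" and U where J: "finite J" "S \<subseteq> (\<Union>j\<in>J. U j)" "\<And>j. j \<in> J \<Longrightarrow> bounded (U j)"
      "(\<Sum>j\<in>J. diameter (U j) powr t) < (\<rho> * M) powr t"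
      by (rule hausdorff_dim_less_finite_cover[OF \<open>compact S\<close> t]) blast
    have "0 < \<rho> * M"
      using \<rho>(1) M(1) by simp
    from separated_copies_cover_sum_ge[where g = g and \<delta> = "\<rho> * M", OF \<open>S \<noteq> {}\<close> X(1) card2 \<open>0 < t\<close> a\<rho>(1) many this _ expand sep J(1-3)]
    have "(\<rho> * M) powr t \<le> (\<Sum>j\<in>J. diameter (U j) powr t)"
      using g by blast
    with J(4) show False
      by simp
  qed
  then show thesis
    by (rule that[OF a(1)])
qed

text \<open>The balls around the points of a separated subset of maximal cardinality cover \<open>S\<close>.\<close>

lemma self_similar_covering_number_le:
  fixes S :: "'a::metric_space set"
  assumes S: "self_similar S" and t: "hausdorff_dim S < ereal t"
  obtains C d0 where "0 < d0"
    "\<And>d. 0 < d \<Longrightarrow> d < d0 \<Longrightarrow> real (covering_number d S) \<le> C * d powr - t"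
proof -
  \<comment> \<open>the \<open>1\<close> keeps \<open>M\<close> positive when \<open>S\<close> is a single point\<close>
  define M where "M = diameter S + 1"
  have "bounded S"
    using S by (auto simp: self_similar_def compact_imp_bounded)
  then have M: "0 < M" "diameter S \<le> M"
    using diameter_ge_0[of S] by (auto simp: M_def)
  then have pos: "0 < 6 * M"
    by simp
  obtain a where a: "0 < a" "\<And>\<rho> X. 0 < \<rho> \<Longrightarrow> \<rho> \<le> 1 \<Longrightarrow> finite X \<Longrightarrow> X \<subseteq> S \<Longrightarrow>
      (\<And>x y. x \<in> X \<Longrightarrow> y \<in> X \<Longrightarrow> x \<noteq> y \<Longrightarrow> 3 * \<rho> * M \<le> dist x y) \<Longrightarrow> real (card X) \<le> (a * \<rho>) powr - t"
    by (rule self_similar_card_separated_le[OF S t M]) blast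
  have "real (covering_number d S) \<le> (a / (6 * M)) powr - t * d powr - t" if d: "0 < d" "d < 6 * M" for d
  proof -
    \<comment> \<open>chosen so that balls of radius \<open>3 * \<rho> * M\<close> have diameter at most \<open>d\<close>\<close>
    define \<rho> where "\<rho> = d / (6 * M)"
    have \<rho>: "0 < \<rho>" "\<rho> \<le> 1" "3 * \<rho> * M = d / 2"
      using d M(1) by (auto simp: \<rho>_def)
    define P where "P X \<longleftrightarrow> finite X \<and> X \<subseteq> S \<and> (\<forall>x\<in>X. \<forall>y\<in>X. x \<noteq> y \<longrightarrow> d / 2 \<le> dist x y)" for X
    have card: "real (card X) \<le> (a * \<rho>) powr - t" if "P X" for X
      using that unfolding P_def by (intro a(2)[OF \<rho>(1,2)]) (auto simp: \<rho>(3))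
    have "\<forall>X. P X \<longrightarrow> card X < nat \<lfloor>(a * \<rho>) powr - t\<rfloor> + 1"
      using card by (auto simp: less_Suc_eq_le le_nat_floor)
    moreover have "P {}"
      by (simp add: P_def)
    ultimately obtain X where X: "P X" "\<And>Y. P Y \<Longrightarrow> card Y \<le> card X"
      using ex_has_greatest_nat[of P "{}" card] by blast
    have "S \<subseteq> \<Union>((\<lambda>x. cball x (d / 2)) ` X)"
    proof
      fix y assume "y \<in> S"
      show "y \<in> \<Union>((\<lambda>x. cball x (d / 2)) ` X)"
      proof (rule ccontr)
        assume "\<not> ?thesis"
        then have far: "d / 2 < dist x y" if "x \<in> X" for x
          using that by (auto simp: not_le)
        then have "y \<notin> X"
          using d(1) by fastforce
        moreover have "P (insert y X)"
          using X(1) \<open>y \<in> S\<close> far by (auto simp: P_def dist_commute less_imp_le)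
        ultimately show False
          using X(2)[of "insert y X"] X(1) by (simp add: P_def)
      qed
    qed
    moreover have "diameter (cball x (d / 2)) \<le> d" for x :: 'a
    proof (rule diameter_le_dist)
      fix u v assume "u \<in> cball x (d / 2)" "v \<in> cball x (d / 2)"
      then show "dist u v \<le> d"
        using dist_triangle[of u v x] by (simp add: dist_commute)
    qed (use d in simp)
    moreover have "finite X"
      using X(1) by (simp add: P_def)
    ultimately have "covering_number d S \<le> card ((\<lambda>x. cball x (d / 2)) ` X)"
      by (intro covering_number_le) auto
    also have "\<dots> \<le> card X"
      using \<open>finite X\<close> by (rule card_image_le)
    finally have "real (covering_number d S) \<le> (a * \<rho>) powr - t"
      using card[OF X(1)] by simp
    also have "\<dots> = (a / (6 * M)) powr - t * d powr - t"
      by (simp add: \<rho>_def flip: powr_mult)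
    finally show ?thesis .
  qed
  then show thesis
    by (rule that[OF pos])
qed

lemma restricted_dim_self_similar:
  fixes S :: "'a::euclidean_space set"
  assumes D: "D \<in> diameter_families" and S: "self_similar S"
  shows "restricted_dim D S = hausdorff_dim S"
proof (rule antisym)
  show "restricted_dim D S \<le> hausdorff_dim S"
  proof (rule restricted_dim_leI)
    show "0 \<le> hausdorff_dim S"
      unfolding hausdorff_dim_def by (intro INF_greatest) auto
    fix s :: real assume s: "0 < s" "hausdorff_dim S < ereal s"
    obtain t where t: "hausdorff_dim S < ereal t" "ereal t < ereal s"
      using ereal_dense2[OF s(2)] by blast
    obtain C d0 where C: "0 < d0" "\<And>d. 0 < d \<Longrightarrow> d < d0 \<Longrightarrow> real (covering_number d S) \<le> C * d powr - t"
      by (rule self_similar_covering_number_le[OF S t(1)]) (rule that)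
    have "bounded S"
      using S by (auto simp: self_similar_def compact_imp_bounded)
    then show "restricted_content D s S = 0"
      using t(2) by (intro restricted_content_eq_0_of_covering_number[OF D _ s(1) _ C]) auto
  qed
  show "hausdorff_dim S \<le> restricted_dim D S"
    by (rule hausdorff_dim_le_restricted_dim[OF D])
qed

section \<open>Borel measurability on the hyperspace\<close>

text \<open>An open cover of a compact set \<open>K\<close> covers every compact set that is Hausdorff close to \<open>K\<close>, so the
  content is upper semicontinuous.\<close>

lemma openin_restricted_content_less:
  assumes D: "D \<in> diameter_families" and "0 < s"
  shows "openin (Metric_space.mtopology compacts hausdorff_dist)
    {K \<in> compacts :: 'a::metric_space set set. restricted_content D s K < c}"
proof -
  interpret Metric_space "compacts :: 'a set set" hausdorff_dist
    by (rule Metric_space_compacts)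
  show ?thesis
    unfolding openin_mtopology
  proof (intro conjI allI impI)
    fix K :: "'a set" assume K: "K \<in> {K \<in> compacts. restricted_content D s K < c}"
    then have less: "restricted_content D s K < c" and "compact K" "K \<noteq> {}"
      by (auto simp: compacts_def)
    from less obtain U :: "nat \<Rightarrow> 'a set" where U: "K \<subseteq> (\<Union>i. U i)" "\<And>i. open (U i)"
      "\<And>i. bounded (U i)" "\<And>i. diameter (U i) \<in> D" "(\<Sum>i. ennreal (diameter (U i) powr s)) < c"
      by (rule restricted_content_open_cover[OF D \<open>0 < s\<close>]) blast
    have "open (\<Union>i. U i)"
      using U(2) by (intro open_UN) simp
    with \<open>compact K\<close> obtain \<epsilon> where \<epsilon>: "\<epsilon> > 0" "(\<Union>x\<in>K. ball x \<epsilon>) \<subseteq> (\<Union>i. U i)"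
      using U(1) by (rule compact_subset_open_imp_ball_epsilon_subset)
    have "restricted_content D s L < c" if L: "L \<in> compacts" "hausdorff_dist K L < \<epsilon>" for L
    proof -
      have "y \<in> (\<Union>x\<in>K. ball x \<epsilon>)" if "y \<in> L" for y
      proof -
        have "infdist y K < \<epsilon>"
          using infdist_le_hausdorff_dist[of L K y] K L that by (simp add: hausdorff_dist_commute[of L K])
        then have "(INF x\<in>K. dist y x) < \<epsilon>"
          using \<open>K \<noteq> {}\<close> by (simp add: infdist_notempty)
        then obtain x where "x \<in> K" "dist y x < \<epsilon>"
          using \<open>K \<noteq> {}\<close> by (subst (asm) cINF_less_iff) auto
        then show ?thesis
          by (auto simp: dist_commute)
      qed
      then have "L \<subseteq> (\<Union>i. U i)"
        using \<epsilon>(2) by blast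
      then show ?thesis
        by (rule le_less_trans[OF restricted_content_upper[OF _ U(3,4)] U(5)])
    qed
    then have "mball K \<epsilon> \<subseteq> {K \<in> compacts. restricted_content D s K < c}"
      by auto
    then show "\<exists>r>0. mball K r \<subseteq> {K \<in> compacts. restricted_content D s K < c}"
      using \<epsilon>(1) by blast
  qed auto
qed

lemma openin_compacts_subset:
  fixes U :: "'a::metric_space set set"
  assumes "openin (Metric_space.mtopology compacts hausdorff_dist) U"
  shows "U \<subseteq> compacts"
  using openin_subset[OF assms] by (simp add: Metric_space.topspace_mtopology[OF Metric_space_compacts])

lemma space_compacts_borel: "space (compacts_borel :: 'a::metric_space set measure) = compacts"
  unfolding compacts_borel_def by (intro space_measure_of) (auto dest!: openin_compacts_subset)

lemma openin_in_sets_compacts_borel: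
  fixes U :: "'a::metric_space set set"
  assumes "openin (Metric_space.mtopology compacts hausdorff_dist) U"
  shows "U \<in> sets compacts_borel"
  unfolding compacts_borel_def using assms
  by (subst sets_measure_of) (auto dest!: openin_compacts_subset)

lemma restricted_content_borel_measurable:
  assumes "D \<in> diameter_families" "0 < s"
  shows "restricted_content D s \<in> borel_measurable (compacts_borel :: 'a::metric_space set measure)"
proof (rule borel_measurableI_less)
  fix c :: ennreal
  show "{K \<in> space (compacts_borel :: 'a set measure). restricted_content D s K < c} \<in> sets compacts_borel"
    unfolding space_compacts_borel
    by (intro openin_in_sets_compacts_borel openin_restricted_content_less assms)
qed

lemma restricted_dim_borel_measurable:
  assumes D: "D \<in> diameter_families"
  shows "restricted_dim D \<in> borel_measurable (compacts_borel :: 'a::metric_space set measure)"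
proof (rule borel_measurableI_less)
  fix a :: ereal
  let ?M = "compacts_borel :: 'a set measure"
  define Q where "Q = {q :: rat. 0 < q \<and> ereal (real_of_rat q) < a}"
  have "(\<exists>q\<in>Q. restricted_content D (real_of_rat q) K = 0) \<longleftrightarrow> restricted_dim D K < a" for K :: "'a set"
  proof
    assume "\<exists>q\<in>Q. restricted_content D (real_of_rat q) K = 0"
    then obtain q where q: "0 < q" "ereal (real_of_rat q) < a" "restricted_content D (real_of_rat q) K = 0"
      by (auto simp: Q_def)
    then have "restricted_dim D K \<le> ereal (real_of_rat q)"
      by (intro restricted_dim_le) auto
    with q(2) show "restricted_dim D K < a"
      by simp
  next
    assume "restricted_dim D K < a"
    then obtain q where q: "restricted_dim D K < ereal (real_of_rat q)" "ereal (real_of_rat q) < a"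
      using ereal_dense3 by blast
    have "0 < ereal (real_of_rat q)"
      using restricted_dim_nonneg q(1) by (rule le_less_trans)
    then have "q \<in> Q"
      using q(2) by (simp add: Q_def)
    then show "\<exists>q\<in>Q. restricted_content D (real_of_rat q) K = 0"
      using restricted_content_eq_0_above[OF D q(1)] by blast
  qed
  then have "{K \<in> space ?M. restricted_dim D K < a} =
      (\<Union>q\<in>Q. {K \<in> space ?M. restricted_content D (real_of_rat q) K = 0})"
    by auto
  also have "\<dots> \<in> sets ?M"
  proof (rule sets.countable_UN'')
    fix q assume "q \<in> Q"
    then have [measurable]: "restricted_content D (real_of_rat q) \<in> borel_measurable ?M"
      by (intro restricted_content_borel_measurable D) (simp add: Q_def)
    show "{K \<in> space ?M. restricted_content D (real_of_rat q) K = 0} \<in> sets ?M"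
      by measurable
  qed auto
  finally show "{K \<in> space ?M. restricted_dim D K < a} \<in> sets ?M" .
qed

section \<open>The properties of the restricted dimension\<close>

theorem proposition3p4:
  fixes D :: "real set"
  assumes "D \<in> diameter_families"
  shows
    "(\<forall>(A :: (real ^ 'n) set) (f :: real ^ 'n \<Rightarrow> real ^ 'n).
        (\<exists>L. L-lipschitz_on UNIV f) \<longrightarrow> restricted_dim D (f ` A) \<le> restricted_dim D A) \<and>
     (\<forall>(A :: (real ^ 'n) set) B. A \<subseteq> B \<longrightarrow> restricted_dim D A \<le> restricted_dim D B) \<and>
     (\<forall>S :: (real ^ 'n) set. self_similar S \<longrightarrow> restricted_dim D S = hausdorff_dim S) \<and>
     (\<forall>A :: nat \<Rightarrow> (real ^ 'n) set.
        restricted_dim D (\<Union>i. A i) = (SUP i. restricted_dim D (A i))) \<and>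
     (\<forall>E :: (real ^ 'n) set.
        \<exists>B. gdelta_in euclidean B \<and> E \<subseteq> B \<and> restricted_dim D B = restricted_dim D E) \<and>
     (restricted_dim D :: (real ^ 'n) set \<Rightarrow> ereal)
        \<in> compacts_borel \<rightarrow>\<^sub>M restrict_space borel {0..ereal (real CARD('n))} \<and>
     (\<forall>E :: (real ^ 'n) set.
        hausdorff_dim E \<le> restricted_dim D E \<and> restricted_dim D E \<le> packing_dim E)"
proof (intro conjI allI impI)
  fix A :: "(real ^ 'n) set" and f :: "real ^ 'n \<Rightarrow> real ^ 'n"
  assume "\<exists>L. L-lipschitz_on UNIV f"
  then show "restricted_dim D (f ` A) \<le> restricted_dim D A"
    using restricted_dim_lipschitz_image[OF assms] by blast
next
  fix A B :: "(real ^ 'n) set"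
  assume "A \<subseteq> B"
  then show "restricted_dim D A \<le> restricted_dim D B"
    by (rule restricted_dim_mono)
next
  fix S :: "(real ^ 'n) set"
  assume "self_similar S"
  then show "restricted_dim D S = hausdorff_dim S"
    by (rule restricted_dim_self_similar[OF assms])
next
  fix A :: "nat \<Rightarrow> (real ^ 'n) set"
  show "restricted_dim D (\<Union>i. A i) = (SUP i. restricted_dim D (A i))"
    by (rule restricted_dim_UN[OF assms])
next
  fix E :: "(real ^ 'n) set"
  obtain B where "gdelta_in euclidean B" "E \<subseteq> B" "restricted_dim D B = restricted_dim D E"
    by (rule gdelta_hull_restricted_dim[OF assms])
  then show "\<exists>B. gdelta_in euclidean B \<and> E \<subseteq> B \<and> restricted_dim D B = restricted_dim D E"
    by (intro exI conjI)
next
  have "restricted_dim D A \<in> {0..ereal (real CARD('n))}" for A :: "(real ^ 'n) set"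
    using restricted_dim_nonneg[of D A] restricted_dim_le_DIM[OF assms, of A] by simp
  then show "(restricted_dim D :: (real ^ 'n) set \<Rightarrow> ereal)
      \<in> compacts_borel \<rightarrow>\<^sub>M restrict_space borel {0..ereal (real CARD('n))}"
    by (intro measurable_restrict_space2 restricted_dim_borel_measurable assms) blast
next
  fix E :: "(real ^ 'n) set"
  show "hausdorff_dim E \<le> restricted_dim D E"
    by (rule hausdorff_dim_le_restricted_dim[OF assms])
  show "restricted_dim D E \<le> packing_dim E"
    by (rule restricted_dim_le_packing_dim[OF assms])
qed

end
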